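(* Let $V$ denote a finite-dimensional irreducible $\square_q$-module of type $1$. Then the $\square_q$-modules $V$ and ${}^{\rho^2}V$ are isomorphic.
   Context: $\mathbb{F}$ is an algebraically closed field of characteristic $0$, and $0\neq q\in\mathbb{F}$ is not a root of unity. $[3]_q=(q^3-q^{-3})/(q-q^{-1})$. All algebras are associative with $1$. $\mathbb{Z}_4=\mathbb{Z}/4\mathbb{Z}$. $\square_q$ is the $\mathbb{F}$-algebra with generators $\{x_i\}_{i\in\mathbb{Z}_4}$ and relations, for $i\in\mathbb{Z}_4$, $$\frac{qx_ix_{i+1}-q^{-1}x_{i+1}x_i}{q-q^{-1}}=1,\qquad x_i^3x_{i+2}-[3]_qx_i^2x_{i+2}x_i+[3]_qx_ix_{i+2}x_i^2-x_{i+2}x_i^3=0.$$ On a finite-dimensional irreducible $\square_q$-module $V$ every $x_i$ is semisimple, and there are an integer $d\ge0$ (the diameter) and nonzero $\gamma\in\mathbb{F}$ (the type) such that the set of distinct eigenvalues of $x_0$ and of $x_2$ is $\{\gamma q^{d-2n}\}_{n=0}^d$, and that of $x_1$ and of $x_3$ is $\{\gamma^{-1}q^{d-2n}\}_{n=0}^d$. Type $1$ means $\gamma=1$. $\rho$ is the automorphism of $\square_q$ with $x_i\mapsto x_{i+1}$ ($i\in\mathbb{Z}_4$). For an automorphism $\varphi$ of $\square_q$, ${}^\varphi V$ is $V$ twisted via $\varphi$: the same vector space, on which $a\in\square_q$ acts as $\varphi(a)$ acts on the original module $V$. *)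

theory Defs
  imports
    "HOL-Library.Poly_Mapping"
    "HOL-Library.Numeral_Type"
    "HOL-Algebra.Module"
    "HOL-Algebra.QuotRing"
    "HOL-Algebra.Algebraic_Closure_Type"
begin

section \<open>Associative unital algebras and their modules\<close>

text \<open>
  The library locale \<open>algebra\<close> only covers commutative algebras, hence the following
  variant for associative algebras with unit. The ground field is a type; the algebra is a record
  with a carrier, because the algebra of interest depends on a parameter.
\<close>

locale assoc_algebra = ring A for A :: "('f::field, 'a) module" (structure) +
  assumes smult_closed: "x \<in> carrier A \<Longrightarrow> c \<odot> x \<in> carrier A"
    and smult_add_right:
      "\<lbrakk>x \<in> carrier A; y \<in> carrier A\<rbrakk> \<Longrightarrow> c \<odot> (x \<oplus> y) = c \<odot> x \<oplus> c \<odot> y"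
    and smult_add_left: "x \<in> carrier A \<Longrightarrow> (b + c) \<odot> x = b \<odot> x \<oplus> c \<odot> x"
    and smult_smult: "x \<in> carrier A \<Longrightarrow> (b * c) \<odot> x = b \<odot> (c \<odot> x)"
    and smult_one: "x \<in> carrier A \<Longrightarrow> 1 \<odot> x = x"
    and smult_mult_left:
      "\<lbrakk>x \<in> carrier A; y \<in> carrier A\<rbrakk> \<Longrightarrow> (c \<odot> x) \<otimes> y = c \<odot> (x \<otimes> y)"
    and smult_mult_right:
      "\<lbrakk>x \<in> carrier A; y \<in> carrier A\<rbrakk> \<Longrightarrow> x \<otimes> (c \<odot> y) = c \<odot> (x \<otimes> y)"

definition alg_automorphism :: "('f, 'a) module \<Rightarrow> ('a \<Rightarrow> 'a) \<Rightarrow> bool" where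
  "alg_automorphism A \<phi> \<longleftrightarrow>
     \<phi> \<in> ring_iso A A \<and> (\<forall>c. \<forall>x\<in>carrier A. \<phi> (c \<odot>\<^bsub>A\<^esub> x) = c \<odot>\<^bsub>A\<^esub> \<phi> x)"

definition (in vector_space) finite_dim :: bool where
  "finite_dim \<longleftrightarrow> (\<exists>B. finite B \<and> span B = UNIV)"

locale alg_module = assoc_algebra A + V: vector_space scale
  for A :: "('f::field, 'a) module" (structure)
    and scale :: "'f \<Rightarrow> 'v::ab_group_add \<Rightarrow> 'v"
    and act :: "'a \<Rightarrow> 'v \<Rightarrow> 'v" +
  assumes act_linear: "a \<in> carrier A \<Longrightarrow> Vector_Spaces.linear scale scale (act a)"
    and act_add: "\<lbrakk>a \<in> carrier A; b \<in> carrier A\<rbrakk> \<Longrightarrow> act (a \<oplus> b) v = act a v + act b v"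
    and act_mult: "\<lbrakk>a \<in> carrier A; b \<in> carrier A\<rbrakk> \<Longrightarrow> act (a \<otimes> b) v = act a (act b v)"
    and act_one: "act \<one> v = v"
    and act_smult: "a \<in> carrier A \<Longrightarrow> act (c \<odot> a) v = scale c (act a v)"
begin

definition alg_submodule :: "'v set \<Rightarrow> bool" where
  "alg_submodule W \<longleftrightarrow> V.subspace W \<and> (\<forall>a\<in>carrier A. act a ` W \<subseteq> W)"

definition irreducible_module :: bool where
  "irreducible_module \<longleftrightarrow>
     (UNIV :: 'v set) \<noteq> {0} \<and> (\<forall>W. alg_submodule W \<longrightarrow> W = {0} \<or> W = UNIV)"

end

definition alg_module_isomorphic ::
  "('f::field, 'a) module \<Rightarrow> ('f \<Rightarrow> 'v::ab_group_add \<Rightarrow> 'v) \<Rightarrow> ('a \<Rightarrow> 'v \<Rightarrow> 'v) \<Rightarrow>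
     ('f \<Rightarrow> 'w::ab_group_add \<Rightarrow> 'w) \<Rightarrow> ('a \<Rightarrow> 'w \<Rightarrow> 'w) \<Rightarrow> bool" where
  "alg_module_isomorphic A scale1 act1 scale2 act2 \<longleftrightarrow>
     (\<exists>f. Vector_Spaces.linear scale1 scale2 f \<and> bij f \<and>
          (\<forall>a\<in>carrier A. \<forall>v. f (act1 a v) = act2 a (f v)))"

definition twist :: "('a \<Rightarrow> 'a) \<Rightarrow> ('a \<Rightarrow> 'v \<Rightarrow> 'v) \<Rightarrow> 'a \<Rightarrow> 'v \<Rightarrow> 'v" where
  "twist \<phi> act = (\<lambda>a. act (\<phi> a))"

lemma alg_module_twist:
  assumes "alg_module A scale act" "alg_automorphism A \<phi>"
  shows "alg_module A scale (twist \<phi> act)"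
proof -
  interpret alg_module A scale act by fact
  have h: "\<phi> \<in> ring_hom A A"
    and s: "\<And>c x. x \<in> carrier A \<Longrightarrow> \<phi> (c \<odot>\<^bsub>A\<^esub> x) = c \<odot>\<^bsub>A\<^esub> \<phi> x"
    using assms(2) unfolding alg_automorphism_def ring_iso_def by auto
  note r = ring_hom_closed[OF h] ring_hom_add[OF h] ring_hom_mult[OF h] ring_hom_one[OF h]
  show ?thesis
    using assms(1)
    unfolding alg_module_def alg_module_axioms_def
    by (auto simp: twist_def r s)
qed

definition eigenvalues :: "('f \<Rightarrow> 'v::zero \<Rightarrow> 'v) \<Rightarrow> ('v \<Rightarrow> 'v) \<Rightarrow> 'f set" where
  "eigenvalues scale T = {c. \<exists>v. v \<noteq> 0 \<and> T v = scale c v}"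


section \<open>The free algebra on the generators indexed by the integers modulo 4\<close>

text \<open>
  The free algebra is the monoid algebra of words: finitely supported functions on words with the
  convolution product of \<^theory>\<open>HOL-Library.Poly_Mapping\<close>. The monoid of words is written
  additively only because that theory expects it. The index type \<^typ>\<open>4\<close> of
  \<^theory>\<open>HOL-Library.Numeral_Type\<close> is the ring of integers modulo 4.
\<close>

datatype 'i word = Word (letters: "'i list")

instantiation word :: (type) monoid_add
begin

definition zero_word :: "'a word" where "0 = Word []"

definition plus_word :: "'a word \<Rightarrow> 'a word \<Rightarrow> 'a word" where
  "u + v = Word (letters u @ letters v)"

instance by standard (auto simp: zero_word_def plus_word_def)

end

type_synonym 'f free_algebra = "4 word \<Rightarrow>\<^sub>0 'f"

definition free_gen :: "4 \<Rightarrow> 'f::field free_algebra" where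
  "free_gen i = Poly_Mapping.single (Word [i]) 1"

definition free_const :: "'f::field \<Rightarrow> 'f free_algebra" where
  "free_const c = Poly_Mapping.single 0 c"

abbreviation free_ring :: "'f::field free_algebra ring" where
  "free_ring \<equiv> ring_of_type_algebra"


section \<open>The algebra \<open>\<box>\<^sub>q\<close>\<close>

definition q_bracket3 :: "'f::field \<Rightarrow> 'f" where
  "q_bracket3 q = (q ^ 3 - inverse q ^ 3) / (q - inverse q)"

definition q_weyl_relator :: "'f::field \<Rightarrow> 4 \<Rightarrow> 'f free_algebra" where
  "q_weyl_relator q i =
     (let x = free_gen i; y = free_gen (i + 1)
      in free_const (1 / (q - inverse q)) *
           (free_const q * x * y - free_const (inverse q) * y * x) - 1)"

definition q_serre_relator :: "'f::field \<Rightarrow> 4 \<Rightarrow> 'f free_algebra" where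
  "q_serre_relator q i =
     (let x = free_gen i; y = free_gen (i + 2); t = free_const (q_bracket3 q)
      in x ^ 3 * y - t * x ^ 2 * y * x + t * x * y * x ^ 2 - y * x ^ 3)"

definition box_ideal :: "'f::field \<Rightarrow> 'f free_algebra set" where
  "box_ideal q = Idl\<^bsub>free_ring\<^esub> (range (q_weyl_relator q) \<union> range (q_serre_relator q))"

definition box_proj :: "'f::field \<Rightarrow> 'f free_algebra \<Rightarrow> 'f free_algebra set" where
  "box_proj q p = box_ideal q +>\<^bsub>free_ring\<^esub> p"

text \<open>The scalar \<open>c\<close> acts on the quotient as multiplication by the class of \<open>c\<cdot>1\<close>.\<close>

definition box_algebra :: "'f::field \<Rightarrow> ('f, 'f free_algebra set) module" where
  "box_algebra q = (let Q = free_ring Quot box_ideal q in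
     \<lparr>carrier = carrier Q, monoid.mult = monoid.mult Q, one = one Q, ring.zero = ring.zero Q,
      add = add Q,
      module.smult = (\<lambda>c C. box_proj q (free_const c) \<otimes>\<^bsub>Q\<^esub> C)\<rparr>)"

definition box_gen :: "'f::field \<Rightarrow> 4 \<Rightarrow> 'f free_algebra set" where
  "box_gen q i = box_proj q (free_gen i)"

text \<open>
  Substituting \<open>i + 1\<close> for \<open>i\<close> in all words: the coefficient of a word in the image is the
  coefficient of the word with every letter decreased by 1.
\<close>

definition free_shift :: "'f::field free_algebra \<Rightarrow> 'f free_algebra" where
  "free_shift = Poly_Mapping.map_key (map_word (\<lambda>i. i - 1))"

text \<open>
  The elements of the quotient are cosets, and \<^term>\<open>free_shift\<close> permutes them. The lemmas
  \<open>rho_automorphism\<close> and \<open>rho_box_gen\<close> below show that this gives the automorphism sending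
  \<open>x\<^sub>i\<close> to \<open>x\<^sub>i\<^sub>+\<^sub>1\<close>.
\<close>

definition rho :: "'f::field free_algebra set \<Rightarrow> 'f free_algebra set" where
  "rho C = free_shift ` C"

text \<open>
  On a finite-dimensional irreducible module with \<open>q\<close> nonzero and not a root of unity, exactly one
  pair \<open>\<gamma>\<close>, \<open>d\<close> satisfies the following predicate.
\<close>

definition box_type_diameter ::
  "'f::field \<Rightarrow> ('f \<Rightarrow> 'v::ab_group_add \<Rightarrow> 'v) \<Rightarrow> ('f free_algebra set \<Rightarrow> 'v \<Rightarrow> 'v) \<Rightarrow>
     'f \<Rightarrow> nat \<Rightarrow> bool" where
  "box_type_diameter q scale act \<gamma> d \<longleftrightarrow>
     \<gamma> \<noteq> 0 \<and>
     (\<forall>i\<in>{0, 2}. eigenvalues scale (act (box_gen q i)) =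
        {\<gamma> * q powi (int d - 2 * int n) | n. n \<le> d}) \<and>
     (\<forall>i\<in>{1, 3}. eigenvalues scale (act (box_gen q i)) =
        {inverse \<gamma> * q powi (int d - 2 * int n) | n. n \<le> d})"

definition box_type ::
  "'f::field \<Rightarrow> ('f \<Rightarrow> 'v::ab_group_add \<Rightarrow> 'v) \<Rightarrow> ('f free_algebra set \<Rightarrow> 'v \<Rightarrow> 'v) \<Rightarrow>
     'f \<Rightarrow> bool" where
  "box_type q scale act \<gamma> \<longleftrightarrow> (\<exists>d. box_type_diameter q scale act \<gamma> d)"


section \<open>Well-definedness\<close>

lemma free_ring_simps [simp]:
  "carrier free_ring = UNIV" "x \<otimes>\<^bsub>free_ring\<^esub> y = x * y" "\<one>\<^bsub>free_ring\<^esub> = 1"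
  "\<zero>\<^bsub>free_ring\<^esub> = 0" "x \<oplus>\<^bsub>free_ring\<^esub> y = x + y"
  by (simp_all add: ring_of_type_algebra_def)

lemma ring_free_ring: "ring (free_ring :: 'f::field free_algebra ring)"
proof -
  have "\<exists>y. x + y = 0" for x :: "'f free_algebra"
    using add.right_inverse by blast
  thus ?thesis
    by unfold_locales (auto simp: algebra_simps Units_def)
qed

lemma ideal_box_ideal: "ideal (box_ideal q) free_ring"
  unfolding box_ideal_def by (intro ring.genideal_ideal ring_free_ring) auto

lemma box_proj_mult:
  "box_proj q x \<otimes>\<^bsub>free_ring Quot box_ideal q\<^esub> box_proj q y = box_proj q (x * y)"
  using ideal.rcoset_mult_add[OF ideal_box_ideal[of q], of x y]
  by (simp add: FactRing_def box_proj_def)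

lemma box_proj_add:
  "box_proj q x \<oplus>\<^bsub>free_ring Quot box_ideal q\<^esub> box_proj q y = box_proj q (x + y)"
  using ring_hom_add[OF ideal.rcos_ring_hom[OF ideal_box_ideal[of q]], of x y]
  by (simp add: box_proj_def)

lemma carrier_box_algebra: "carrier (box_algebra q) = range (box_proj q)"
  by (auto simp: box_algebra_def FactRing_def A_RCOSETS_def' box_proj_def Let_def)

lemma box_algebra_simps:
  "box_proj q x \<otimes>\<^bsub>box_algebra q\<^esub> box_proj q y = box_proj q (x * y)"
  "box_proj q x \<oplus>\<^bsub>box_algebra q\<^esub> box_proj q y = box_proj q (x + y)"
  "c \<odot>\<^bsub>box_algebra q\<^esub> box_proj q x = box_proj q (free_const c * x)"
  "\<one>\<^bsub>box_algebra q\<^esub> = box_proj q 1"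
  by (simp_all add: box_algebra_def Let_def box_proj_mult box_proj_add)
     (simp add: FactRing_def box_proj_def)

lemma free_const_simps:
  "free_const (a + b) = free_const a + free_const b"
  "free_const (a * b) = free_const a * free_const b"
  "free_const 1 = 1"
  by (simp_all add: free_const_def single_add mult_single)

lemma poly_mapping_induct_single:
  assumes "P 0" "\<And>k v p. P p \<Longrightarrow> P (p + Poly_Mapping.single k v)"
  shows "P (p :: 'k \<Rightarrow>\<^sub>0 'v::monoid_add)"
proof (induction p rule: update_induct)
  case const
  show ?case by (rule assms(1))
next
  case (update p k v)
  have "Poly_Mapping.update k v p = p + Poly_Mapping.single k v"
    using update(1)
    by (intro poly_mapping_eqI)
       (auto simp: lookup_update lookup_add lookup_single when_def in_keys_iff)
  thus ?case using assms(2)[OF update(3)] by simp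
qed

lemma free_const_central: "free_const c * x = x * free_const c"
proof (induction x rule: poly_mapping_induct_single)
  case (2 k v p)
  thus ?case by (simp add: algebra_simps free_const_def mult_single)
qed simp

lemma assoc_algebra_box_algebra: "assoc_algebra (box_algebra q)"
proof -
  have "ring (free_ring Quot box_ideal q)"
    by (rule ideal.quotient_is_ring[OF ideal_box_ideal])
  then interpret Q: ring "free_ring Quot box_ideal q" .
  have "abelian_group (box_algebra q)"
    by (rule abelian_groupI)
       (use Q.a_ac Q.add.l_inv_ex in \<open>auto simp: box_algebra_def Let_def\<close>)
  moreover have "Group.monoid (box_algebra q)"
    using Q.monoid_axioms unfolding Group.monoid_def box_algebra_def Let_def by simp
  ultimately interpret ring "box_algebra q"
    using Q.l_distr Q.r_distr
    by (intro ring.intro ring_axioms.intro) (auto simp: box_algebra_def Let_def)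
  show ?thesis
  proof (unfold_locales, goal_cases)
    case (7 x y c)
    then obtain u v where uv: "x = box_proj q u" "y = box_proj q v"
      by (auto simp: carrier_box_algebra)
    have "u * (free_const c * v) = free_const c * (u * v)"
      by (metis free_const_central mult.assoc)
    thus ?case by (simp add: uv box_algebra_simps)
  qed (auto simp: carrier_box_algebra box_algebra_simps free_const_simps algebra_simps)
qed

lemma inj_word_shift: "inj (map_word (\<lambda>i::4. i - 1))"
  by (rule word.inj_map) (auto intro: injI)

lemma free_shift_add [simp]: "free_shift (x + y) = free_shift x + free_shift y"
  by (simp add: free_shift_def map_key_plus[OF inj_word_shift])

lemma free_shift_single [simp]:
  "free_shift (Poly_Mapping.single w c) = Poly_Mapping.single (map_word (\<lambda>i. i + 1) w) c"
proof -
  have "map_word (\<lambda>i::4. i - 1) (map_word (\<lambda>i. i + 1) w) = w"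
    by (simp add: word.map_comp o_def word.map_ident)
  thus ?thesis
    using map_key_single[OF inj_word_shift, of "map_word (\<lambda>i. i + 1) w" c]
    by (simp add: free_shift_def)
qed

lemma free_shift_0 [simp]: "free_shift 0 = 0"
  by (simp add: free_shift_def map_key_zero[OF inj_word_shift])

lemma free_shift_const [simp]: "free_shift (free_const c) = free_const c"
  by (simp add: free_const_def zero_word_def)

lemma free_shift_1 [simp]: "free_shift 1 = 1"
  using free_shift_const[of 1] by (simp add: free_const_simps)

lemma free_shift_gen [simp]: "free_shift (free_gen i) = free_gen (i + 1)"
  by (simp add: free_gen_def)

lemma map_word_plus: "map_word f (u + v) = map_word f u + map_word f v"
  by (cases u; cases v) (simp add: plus_word_def)

lemma free_shift_mult [simp]: "free_shift (x * y) = free_shift x * free_shift y"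
proof (induction x rule: poly_mapping_induct_single)
  case (2 k v p)
  have "free_shift (Poly_Mapping.single k v * y) =
          free_shift (Poly_Mapping.single k v) * free_shift y"
    by (induction y rule: poly_mapping_induct_single)
       (simp_all add: distrib_left mult_single map_word_plus)
  thus ?case using 2 by (simp add: distrib_right)
qed simp

lemma free_shift_diff [simp]: "free_shift (x - y) = free_shift x - free_shift y"
  by (metis add_diff_cancel_right' diff_add_cancel free_shift_add)

lemma free_shift_power [simp]: "free_shift (x ^ n) = free_shift x ^ n"
  by (induction n) simp_all

lemma free_shift_4: "(free_shift ^^ 4) x = x"
proof (induction x rule: poly_mapping_induct_single)
  case (2 k v p)
  have four: "(4 :: 4) = 0" by simp
  have "map_word (\<lambda>i. i + 1) (map_word (\<lambda>i. i + 1) (map_word (\<lambda>i. i + 1) (map_word (\<lambda>i. i + 1) k))) = k"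
    by (simp add: word.map_comp o_def add.assoc word.map_ident four)
  thus ?case using 2 by (simp add: numeral_eq_Suc)
qed (simp add: numeral_eq_Suc)

lemma free_shift_box_ideal_subset: "free_shift ` box_ideal q \<subseteq> box_ideal q"
proof -
  interpret R: ring "free_ring :: 'a free_algebra ring" by (rule ring_free_ring)
  interpret I: ideal "box_ideal q" free_ring by (rule ideal_box_ideal)
  interpret h: ring_hom_ring free_ring free_ring "free_shift :: 'a free_algebra \<Rightarrow> _"
    by unfold_locales (auto simp: ring_hom_def)
  have J: "ideal {x. free_shift x \<in> box_ideal q} free_ring"
    using h.ideal_vimage[OF ideal_box_ideal] by (simp add: vimage_def)
  have gens: "range (q_weyl_relator q) \<union> range (q_serre_relator q) \<subseteq> box_ideal q"
    unfolding box_ideal_def by (rule R.genideal_self) simp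
  have "free_shift (q_weyl_relator q i) = q_weyl_relator q (i + 1)"
    "free_shift (q_serre_relator q i) = q_serre_relator q (i + 1)" for i
    by (simp_all add: q_weyl_relator_def q_serre_relator_def Let_def algebra_simps)
  hence "range (q_weyl_relator q) \<union> range (q_serre_relator q) \<subseteq> {x. free_shift x \<in> box_ideal q}"
    using gens by auto
  hence "box_ideal q \<subseteq> {x. free_shift x \<in> box_ideal q}"
    unfolding box_ideal_def[of q] using R.genideal_minimal[OF J] by (simp add: box_ideal_def)
  thus ?thesis by auto
qed

lemma free_shift_box_ideal: "free_shift ` box_ideal q = box_ideal q"
proof
  show "box_ideal q \<subseteq> free_shift ` box_ideal q"
  proof
    fix x assume "x \<in> box_ideal q"
    hence "(free_shift ^^ 3) x \<in> box_ideal q"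
      using free_shift_box_ideal_subset[of q] by (auto simp: numeral_eq_Suc)
    moreover have "x = free_shift ((free_shift ^^ 3) x)"
      using free_shift_4[of x] by (simp add: numeral_eq_Suc)
    ultimately show "x \<in> free_shift ` box_ideal q" by blast
  qed
qed (rule free_shift_box_ideal_subset)

lemma rho_box_proj: "rho (box_proj q x) = box_proj q (free_shift x)"
proof -
  have "free_shift ` (\<lambda>h. h + x) ` box_ideal q = (\<lambda>h. h + free_shift x) ` free_shift ` box_ideal q"
    by (auto simp: image_image)
  thus ?thesis
    unfolding free_shift_box_ideal rho_def box_proj_def
    by (simp add: a_r_coset_def' UNION_singleton_eq_range)
qed

lemma rho_box_gen: "rho (box_gen q i) = box_gen q (i + 1)"
  by (simp add: box_gen_def rho_box_proj)

lemma rho_automorphism: "alg_automorphism (box_algebra q) rho"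
proof -
  have "(free_shift ^^ 4) = (id :: 'a free_algebra \<Rightarrow> _)"
    by (intro ext) (simp add: free_shift_4)
  hence bij: "bij (free_shift :: 'a free_algebra \<Rightarrow> _)"
    by (intro o_bij[of "free_shift ^^ 3"]) (auto simp: numeral_eq_Suc fun_eq_iff)
  have "bij_betw rho (range (box_proj q)) (range (box_proj q))"
  proof (rule bij_betw_imageI)
    show "inj_on rho (range (box_proj q))"
      using inj_image_eq_iff[OF bij_is_inj[OF bij]] by (auto simp: inj_on_def rho_def)
    have "rho ` range (box_proj q) = range (\<lambda>x. box_proj q (free_shift x))"
      by (simp add: image_image rho_box_proj)
    also have "\<dots> = range (box_proj q)"
      using bij_is_surj[OF bij] by (metis image_image)
    finally show "rho ` range (box_proj q) = range (box_proj q)" .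
  qed
  thus ?thesis
    unfolding alg_automorphism_def ring_iso_def ring_hom_def carrier_box_algebra
    by (auto simp: box_algebra_simps rho_box_proj)
qed

lemma rho_square_automorphism: "alg_automorphism (box_algebra q) (rho ^^ 2)"
proof -
  have "rho \<in> ring_iso (box_algebra q) (box_algebra q)"
    using rho_automorphism[of q] by (simp add: alg_automorphism_def)
  from ring_iso_set_trans[OF this this] rho_automorphism[of q]
  show ?thesis
    by (auto simp: alg_automorphism_def numeral_2_eq_2 comp_def carrier_box_algebra rho_box_proj)
qed

end

theory Submission
  imports Defs "HOL-Library.Product_Plus"
begin

text \<open>
  Write \<open>\<theta>\<^sub>n = q\<^sup>d\<^sup>-\<^sup>2\<^sup>n\<close>. Irreducibility makes every generator \<open>x\<^sub>i\<close> diagonalizable with eigenvalues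
  \<open>\<theta>\<^sub>0, \<dots>, \<theta>\<^sub>d\<close>, because the eigenvectors of \<open>x\<^sub>i\<close> span a submodule. Let \<open>e\<close> and \<open>e'\<close> be the
  projections onto the top eigenspaces (eigenvalue \<open>\<theta>\<^sub>0\<close>) of \<open>x\<^sub>3\<close> and of \<open>x\<^sub>1\<close> along the other
  eigenspaces. An isomorphism from \<open>V\<close> to its twist by \<open>\<rho>\<^sup>2\<close> must carry the image of \<open>e\<close> to the
  image of \<open>e'\<close> and exchange the actions of \<open>x\<^sub>1\<close> and \<open>x\<^sub>3\<close>; the proof constructs it from what it
  does there.

  The first ingredient is a symmetry. By the Serre relations \<open>x\<^sub>1\<close> is tridiagonal with respect to
  the eigenspaces of \<open>x\<^sub>3\<close>, and conversely. Hence, if \<open>x\<^sub>1 y = \<theta>\<^sub>0 y\<close>, then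
  \<open>e f(x\<^sub>1) g(x\<^sub>3) y = e g(x\<^sub>1) f(x\<^sub>3) y\<close> for all polynomials \<open>f, g\<close>
  (\<open>proj_poly_symmetric\<close>): on the Newton polynomials with nodes \<open>\<theta>\<^sub>0, \<theta>\<^sub>1, \<dots>\<close> both sides vanish unless
  \<open>f\<close> and \<open>g\<close> are the same one. Taking \<open>g(x\<^sub>3) = e\<close>, so that \<open>g(x\<^sub>1) = e'\<close>, yields
  \<open>e f(x\<^sub>1) e y = e e' f(x\<^sub>3) y\<close>: the restriction of \<open>e\<close> to the image of \<open>e'\<close> intertwines the
  compressions \<open>e' f(x\<^sub>3) e'\<close> with the compressions \<open>e f(x\<^sub>1) e\<close>.

  The second ingredient says that these compressions control everything
  (\<open>words_preserve_subspace\<close>): a subspace of the image of \<open>e\<close> preserved by all \<open>e x\<^sub>1\<^sup>k e\<close> is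
  preserved by \<open>e w e\<close> for every word \<open>w\<close> in \<open>x\<^sub>1, x\<^sub>3\<close>. This uses that, for fixed \<open>m\<close> and
  \<open>i + k\<close>, any \<open>2 m + 1\<close> of the words \<open>x\<^sub>1\<^sup>i x\<^sub>3\<^sup>m x\<^sub>1\<^sup>k\<close> span the others
  (\<open>exchange\<close>), which allows one to flatten a word until \<open>e\<close> can be inserted into it.

  The third ingredient is the \<open>q\<close>-Weyl relations. They identify the top eigenspace of \<open>x\<^sub>i\<^sub>+\<^sub>1\<close> with
  the bottom eigenspace of \<open>x\<^sub>i\<close>, and the kernel of the projection onto the top eigenspace of \<open>x\<^sub>i\<close>
  with that of the projection onto the bottom eigenspace of \<open>x\<^sub>i\<^sub>+\<^sub>1\<close>. So
  \<open>e\<close> and \<open>e'\<close> restrict to bijections between their two images, and the subspace generated under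
  \<open>x\<^sub>1, x\<^sub>3\<close> from suitable top vectors is stable under \<open>x\<^sub>0\<close> and \<open>x\<^sub>2\<close> as well
  (\<open>generated_submodule\<close>).

  These are applied to \<open>V \<times> V\<close>, with \<open>x\<^sub>i\<close> acting as \<open>x\<^sub>i\<close> on the first and as \<open>x\<^sub>i\<^sub>+\<^sub>2\<close> on the
  second factor. The set of all \<open>(e y, y)\<close> with \<open>x\<^sub>1 y = \<theta>\<^sub>0 y\<close> is preserved by the compressions, so
  it generates a submodule \<open>M\<close> that the projection onto the top eigenspace of \<open>x\<^sub>3\<close> on \<open>V \<times> V\<close> maps
  back into this set. Therefore \<open>M\<close> contains neither factor, and since \<open>V\<close> is irreducible, \<open>M\<close> is
  the graph of an isomorphism.
\<close>

section \<open>Lagrange and Newton polynomials\<close>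

definition lagrange_poly :: "('k \<Rightarrow> 'f::field) \<Rightarrow> 'k set \<Rightarrow> 'k \<Rightarrow> 'f poly" where
  "lagrange_poly y S k =
     smult (1 / (\<Prod>j\<in>S - {k}. y k - y j)) (\<Prod>j\<in>S - {k}. [:- y j, 1:])"

lemma poly_lagrange_poly:
  assumes "finite S" "inj_on y S" "k \<in> S" "j \<in> S"
  shows "poly (lagrange_poly y S k) (y j) = (if j = k then 1 else 0)"
proof (cases "j = k")
  case True
  have "(\<Prod>j\<in>S - {k}. y k - y j) \<noteq> 0"
    using assms by (auto simp: prod_zero_iff inj_on_def)
  thus ?thesis using True by (simp add: lagrange_poly_def poly_prod)
next
  case False
  hence "(\<Prod>i\<in>S - {k}. y j - y i) = 0"
    using assms by (auto simp: prod_zero_iff)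
  thus ?thesis using False by (simp add: lagrange_poly_def poly_prod)
qed

lemma linear_factor_mult_lagrange_poly:
  assumes "finite S" "k \<in> S"
  shows "[:- y k, 1:] * lagrange_poly y S k =
    smult (1 / (\<Prod>j\<in>S - {k}. y k - y j)) (\<Prod>j\<in>S. [:- y j, 1:])"
  unfolding lagrange_poly_def prod.remove[OF assms] by simp

lemma degree_lagrange_poly:
  assumes "finite S" "k \<in> S"
  shows "degree (lagrange_poly y S k) < card S"
proof -
  have "degree (lagrange_poly y S k) \<le> (\<Sum>j\<in>S - {k}. degree [:- y j, 1:])"
    unfolding lagrange_poly_def
    by (rule order_trans[OF degree_smult_le])
       (use degree_prod_sum_le[of "S - {k}" "\<lambda>j. [:- y j, 1:]"] assms in \<open>simp add: o_def\<close>)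
  also have "\<dots> = card (S - {k})" by simp
  also have "\<dots> < card S" using assms by (meson card_Diff1_less)
  finally show ?thesis .
qed

lemma lagrange_interpolation:
  assumes "finite S" "inj_on y S" "degree p < card S"
  shows "(\<Sum>k\<in>S. smult (poly p (y k)) (lagrange_poly y S k)) = p"
proof (rule poly_eqI_degree)
  show "poly (\<Sum>k\<in>S. smult (poly p (y k)) (lagrange_poly y S k)) x = poly p x"
    if x: "x \<in> y ` S" for x
  proof -
    obtain j where j: "j \<in> S" "x = y j" using x by auto
    have "(\<Sum>k\<in>S. poly p (y k) * poly (lagrange_poly y S k) (y j)) =
          (\<Sum>k\<in>S. if k = j then poly p (y j) else 0)"
      using assms j by (intro sum.cong) (auto simp: poly_lagrange_poly)
    thus ?thesis using assms(1) j by (simp add: poly_sum)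
  qed
  have c: "card (y ` S) = card S" using assms(2) by (rule card_image)
  show "card (y ` S) > degree p" using assms c by simp
  show "card (y ` S) > degree (\<Sum>k\<in>S. smult (poly p (y k)) (lagrange_poly y S k))"
    unfolding c
    by (intro degree_sum_less)
       (use assms degree_lagrange_poly[OF assms(1)] in \<open>auto intro: le_less_trans[OF degree_smult_le]\<close>)
qed

lemma sum_lagrange_poly:
  assumes "finite S" "inj_on y S" "S \<noteq> {}"
  shows "(\<Sum>k\<in>S. lagrange_poly y S k) = 1"
  using lagrange_interpolation[OF assms(1,2), of 1] assms by (simp add: card_gt_0_iff)

definition newton_poly :: "(nat \<Rightarrow> 'f::field) \<Rightarrow> nat \<Rightarrow> 'f poly" where
  "newton_poly y n = (\<Prod>k<n. [:- y k, 1:])"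

lemma degree_newton_poly [simp]: "degree (newton_poly y n) = n"
  unfolding newton_poly_def by (subst degree_prod_eq_sum_degree) auto

lemma monic_newton_poly: "coeff (newton_poly y n) n = 1"
  using lead_coeff_prod[of "\<lambda>k. [:- y k, 1:]" "{..<n}"] degree_newton_poly[of y n]
  by (simp add: newton_poly_def)

lemma poly_newton_poly_eq_0: "k < n \<Longrightarrow> poly (newton_poly y n) (y k) = 0"
  by (auto simp: newton_poly_def poly_prod prod_zero_iff)

text \<open>
  The Newton polynomials contain exactly one monic polynomial of each degree, so they span.
\<close>

lemma newton_poly_induct [case_names zero add newton]:
  assumes "P 0"
    and "\<And>p c n. P p \<Longrightarrow> P (smult c (newton_poly y n)) \<Longrightarrow> P (p + smult c (newton_poly y n))"
    and "\<And>c n. P (smult c (newton_poly y n))"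
  shows "P p"
proof (induction "degree p" arbitrary: p rule: less_induct)
  case less
  define r where "r = p - smult (lead_coeff p) (newton_poly y (degree p))"
  have "degree r \<le> degree p"
    unfolding r_def by (intro degree_diff_le) (auto intro: order_trans[OF degree_smult_le])
  have "coeff r (degree p) = 0" by (simp add: r_def monic_newton_poly)
  have "P r"
  proof (cases "degree p = 0")
    case True
    hence "r = 0" using \<open>degree r \<le> degree p\<close> \<open>coeff r (degree p) = 0\<close>
      by (metis eq_zero_or_degree_less less_nat_zero_code)
    thus ?thesis using assms(1) by simp
  next
    case False
    hence "degree r < degree p" using \<open>degree r \<le> degree p\<close> \<open>coeff r (degree p) = 0\<close>
      by (metis degree_0 eq_zero_or_degree_less gr0I)
    thus ?thesis by (rule less)
  qed
  hence "P (r + smult (lead_coeff p) (newton_poly y (degree p)))" using assms by blast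
  thus ?case by (simp add: r_def)
qed

section \<open>Polynomials in a linear operator\<close>

locale linear_operator = vector_space scale
  for scale :: "'f::field \<Rightarrow> 'v::ab_group_add \<Rightarrow> 'v" +
  fixes T :: "'v \<Rightarrow> 'v"
  assumes op_add: "T (v + w) = T v + T w"
    and op_scale: "T (scale c v) = scale c (T v)"
begin

lemma op_zero: "T 0 = 0"
  using op_scale[of 0 0] by simp

lemma op_diff: "T (v - w) = T v - T w"
  using op_add[of "v - w" w] by simp

lemma op_sum: "T (\<Sum>i\<in>I. f i) = (\<Sum>i\<in>I. T (f i))"
  by (induction I rule: infinite_finite_induct) (simp_all add: op_zero op_add)

lemma linear_operator_funpow: "linear_operator scale (T ^^ n)"
proof unfold_locales
  show "(T ^^ n) (v + w) = (T ^^ n) v + (T ^^ n) w"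
    "(T ^^ n) (scale c v) = scale c ((T ^^ n) v)" for v w c
    by (induction n) (simp_all add: op_add op_scale)
qed

text \<open>Horner's scheme makes the recursion over \<^const>\<open>pCons\<close> immediate.\<close>

definition op_poly :: "'f poly \<Rightarrow> 'v \<Rightarrow> 'v" where
  "op_poly p v = fold_coeffs (\<lambda>a w. scale a v + T w) p 0"

lemma op_poly_0 [simp]: "op_poly 0 v = 0"
  by (simp add: op_poly_def)

lemma op_poly_pCons: "op_poly (pCons a p) v = scale a v + T (op_poly p v)"
  by (cases "p = 0 \<and> a = 0") (auto simp: op_poly_def op_zero)

lemma op_poly_1 [simp]: "op_poly 1 v = v"
  by (simp add: one_pCons op_poly_pCons op_zero)

lemma op_poly_linear_factor: "op_poly [:- c, 1:] v = T v - scale c v"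
  by (simp add: op_poly_pCons op_zero)

lemma op_poly_add: "op_poly (p + r) v = op_poly p v + op_poly r v"
  by (induction p r rule: poly_induct2) (simp_all add: op_poly_pCons op_add scale_left_distrib)

lemma op_poly_smult: "op_poly (smult c p) v = scale c (op_poly p v)"
  by (induction p) (simp_all add: op_poly_pCons op_scale scale_right_distrib)

lemma op_poly_sum: "op_poly (\<Sum>i\<in>I. f i) v = (\<Sum>i\<in>I. op_poly (f i) v)"
  by (induction I rule: infinite_finite_induct) (simp_all add: op_poly_add)

lemma op_poly_mult: "op_poly (p * r) v = op_poly p (op_poly r v)"
  by (induction p) (simp_all add: op_poly_pCons op_poly_add op_poly_smult)

lemma op_poly_monom: "op_poly (monom c n) v = scale c ((T ^^ n) v)"
  by (induction n) (simp_all add: monom_0 monom_Suc op_poly_pCons op_zero op_scale)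

lemma linear_operator_op_poly: "linear_operator scale (op_poly p)"
proof unfold_locales
  show "op_poly p (v + w) = op_poly p v + op_poly p w"
    "op_poly p (scale c v) = scale c (op_poly p v)" for v w c
    by (induction p)
       (simp_all add: op_poly_pCons op_add op_scale scale_right_distrib mult.commute add_ac)
qed

lemma op_poly_eigenvector:
  assumes "T v = scale c v"
  shows "op_poly p v = scale (poly p c) v"
  by (induction p) (simp_all add: op_poly_pCons op_scale assms scale_left_distrib mult_ac)

lemma funpow_eigenvector:
  assumes "T v = scale c v"
  shows "(T ^^ n) v = scale (c ^ n) v"
  using op_poly_eigenvector[OF assms, of "monom 1 n"] by (simp add: op_poly_monom poly_monom)

lemma op_poly_eq_sum:
  assumes "\<And>k. k \<ge> n \<Longrightarrow> coeff p k = 0"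
  shows "op_poly p v = (\<Sum>k<n. scale (coeff p k) ((T ^^ k) v))"
proof -
  have "p = (\<Sum>k<n. monom (coeff p k) k)"
    by (rule poly_eqI) (use assms in \<open>auto simp: coeff_sum not_less\<close>)
  hence "op_poly p v = op_poly (\<Sum>k<n. monom (coeff p k) k) v" by simp
  thus ?thesis by (simp add: op_poly_sum op_poly_monom)
qed

lemma funpow_eq_monic_poly:
  assumes "degree p = n" "coeff p n = 1"
  shows "(T ^^ n) v = op_poly p v - (\<Sum>k<n. scale (coeff p k) ((T ^^ k) v))"
  using op_poly_eq_sum[of "Suc n" p v] assms by (simp add: coeff_eq_0)

lemma op_poly_in_subspace:
  assumes "subspace W" "\<And>w. w \<in> W \<Longrightarrow> T w \<in> W" "v \<in> W"
  shows "op_poly p v \<in> W"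
  by (induction p)
     (use assms in \<open>auto simp: op_poly_pCons intro: subspace_0 subspace_add subspace_scale\<close>)

text \<open>
  A product of distinct linear factors killing a vector splits it into eigenvectors, by the
  partition of unity into Lagrange polynomials.
\<close>

lemma eigenvector_decomposition:
  assumes "finite S" "inj_on y S" "S \<noteq> {}" "op_poly (\<Prod>k\<in>S. [:- y k, 1:]) v = 0"
  shows "v = (\<Sum>k\<in>S. op_poly (lagrange_poly y S k) v)"
    and "k \<in> S \<Longrightarrow> T (op_poly (lagrange_poly y S k) v) = scale (y k) (op_poly (lagrange_poly y S k) v)"
proof -
  show "v = (\<Sum>k\<in>S. op_poly (lagrange_poly y S k) v)"
    using op_poly_sum[of "lagrange_poly y S" S v] sum_lagrange_poly[OF assms(1-3)] by simp
  assume "k \<in> S"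
  have "op_poly [:- y k, 1:] (op_poly (lagrange_poly y S k) v) = 0"
    using assms(4) linear_factor_mult_lagrange_poly[OF assms(1) \<open>k \<in> S\<close>, of y]
    by (metis op_poly_mult op_poly_smult scale_zero_right)
  thus "T (op_poly (lagrange_poly y S k) v) = scale (y k) (op_poly (lagrange_poly y S k) v)"
    by (simp add: op_poly_linear_factor)
qed

end

section \<open>Diagonalizable operators with \<open>q\<close>-geometric spectrum\<close>

definition q_geometric :: "'f::field \<Rightarrow> nat \<Rightarrow> nat \<Rightarrow> 'f" where
  "q_geometric q d n = q powi (int d - 2 * int n)"

locale q_not_root_of_unity =
  fixes q :: "'f::field"
  assumes q_nonzero: "q \<noteq> 0" and q_power_neq_1: "n > 0 \<Longrightarrow> q ^ n \<noteq> 1"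
begin

lemma q_powi_eq_1_iff: "q powi k = 1 \<longleftrightarrow> k = 0"
proof
  assume k: "q powi k = 1"
  show "k = 0"
  proof (rule ccontr)
    assume "k \<noteq> 0"
    have "q ^ nat \<bar>k\<bar> = 1"
      using k by (cases "k \<ge> 0") (auto simp: power_int_def power_inverse)
    thus False using q_power_neq_1[of "nat \<bar>k\<bar>"] \<open>k \<noteq> 0\<close> by simp
  qed
qed simp

lemma q_powi_eq_iff: "q powi k = q powi l \<longleftrightarrow> k = l"
proof -
  have "q powi k = q powi (k - l) * q powi l"
    using q_nonzero by (simp flip: power_int_add)
  thus ?thesis using q_nonzero q_powi_eq_1_iff[of "k - l"] by auto
qed

lemma q_diff_nonzero: "q - inverse q \<noteq> 0"
proof
  assume "q - inverse q = 0"
  hence "q ^ 2 = 1" using q_nonzero by (simp add: power2_eq_square field_simps)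
  thus False using q_power_neq_1[of 2] by simp
qed

lemma q_bracket3_eq: "q_bracket3 q = q ^ 2 + 1 + inverse q ^ 2"
proof -
  have "q ^ 3 - inverse q ^ 3 = (q ^ 2 + q * inverse q + inverse q ^ 2) * (q - inverse q)"
    by (simp add: power2_eq_square power3_eq_cube algebra_simps)
  thus ?thesis using q_diff_nonzero q_nonzero by (simp add: q_bracket3_def)
qed

lemma q_geometric_nonzero [simp]: "q_geometric q d n \<noteq> 0"
  using q_nonzero by (simp add: q_geometric_def)

lemma q_geometric_eq_iff: "q_geometric q d m = q_geometric q d n \<longleftrightarrow> m = n"
  by (simp add: q_geometric_def q_powi_eq_iff)

lemma q_geometric_eq_shift_iff: "q_geometric q d m = q powi (2 * k) * q_geometric q d n \<longleftrightarrow>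
    int m + k = int n"
  using q_nonzero by (auto simp: q_geometric_def q_powi_eq_iff simp flip: power_int_add)

lemma inj_on_q_geometric: "inj_on (q_geometric q d) S"
  by (simp add: inj_on_def q_geometric_eq_iff)

text \<open>
  The cubic Serre relation in \<open>x, y\<close>, evaluated on an eigenvector of \<open>x\<close> for \<open>t\<close>, says that this
  cubic polynomial in \<open>x\<close> kills the image under \<open>y\<close>; its roots are \<open>t\<close> and the two neighbours of
  \<open>t\<close> in a \<open>q\<close>-geometric progression of ratio \<open>q\<^sup>2\<close>.
\<close>

lemma serre_cubic_factorization:
  "[:- (t ^ 3), q_bracket3 q * t ^ 2, - (q_bracket3 q * t), 1:] =
     (\<Prod>k\<in>{-1, 0, 1::int}. [:- (q powi (2 * k) * t), 1:])"
  using q_nonzero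
  by (simp add: q_bracket3_eq power_int_minus power2_eq_square power3_eq_cube field_simps)

end

text \<open>
  An annihilating product of distinct linear factors is diagonalizability in a form that passes to
  componentwise operators on \<open>V \<times> V\<close>; the eigenspaces come back through the projections \<open>proj\<close>.
\<close>

locale q_geometric_operator = linear_operator scale T + q_not_root_of_unity q
  for scale :: "'f::field \<Rightarrow> 'v::ab_group_add \<Rightarrow> 'v" and T :: "'v \<Rightarrow> 'v" and q :: 'f +
  fixes d :: nat
  assumes annihilated: "op_poly (\<Prod>n\<le>d. [:- q_geometric q d n, 1:]) v = 0"
begin

abbreviation th :: "nat \<Rightarrow> 'f" where "th \<equiv> q_geometric q d"

definition proj :: "nat \<Rightarrow> 'v \<Rightarrow> 'v" where
  "proj n = op_poly (lagrange_poly th {..d} n)"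

sublocale proj: linear_operator scale "proj n" for n
  unfolding proj_def by (rule linear_operator_op_poly)

lemma sum_proj: "(\<Sum>n\<le>d. proj n v) = v"
  unfolding proj_def
  using eigenvector_decomposition(1)[of "{..d}" th v] annihilated inj_on_q_geometric by simp

lemma op_proj: "n \<le> d \<Longrightarrow> T (proj n v) = scale (th n) (proj n v)"
  unfolding proj_def
  using eigenvector_decomposition(2)[of "{..d}" th v n] annihilated inj_on_q_geometric by simp

lemma proj_eigenvector:
  assumes "T v = scale (th m) v" "m \<le> d" "n \<le> d"
  shows "proj n v = (if m = n then v else 0)"
  using assms unfolding proj_def op_poly_eigenvector[OF assms(1)]
  by (auto simp: poly_lagrange_poly inj_on_q_geometric)

lemma proj_op: "n \<le> d \<Longrightarrow> proj n (T v) = scale (th n) (proj n v)"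
proof -
  assume n: "n \<le> d"
  have "proj n (T v) = op_poly (lagrange_poly th {..d} n * [:0, 1:]) v"
    by (simp only: proj_def op_poly_mult op_poly_pCons) (simp add: op_zero)
  also have "\<dots> = op_poly ([:0, 1:] * lagrange_poly th {..d} n) v"
    by (simp only: mult.commute)
  also have "\<dots> = T (proj n v)"
    by (simp only: proj_def op_poly_mult op_poly_pCons) (simp add: op_zero)
  finally show ?thesis using op_proj[OF n] by simp
qed

lemma proj_op_poly: "n \<le> d \<Longrightarrow> proj n (op_poly p v) = scale (poly p (th n)) (proj n v)"
  by (induction p) (simp_all add: op_poly_pCons proj.op_zero proj.op_add proj.op_scale proj_op
        scale_left_distrib)

lemma op_poly_proj: "n \<le> d \<Longrightarrow> op_poly p (proj n v) = scale (poly p (th n)) (proj n v)"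
  by (rule op_poly_eigenvector) (rule op_proj)

lemma funpow_proj: "n \<le> d \<Longrightarrow> (T ^^ k) (proj n v) = scale (th n ^ k) (proj n v)"
  by (rule funpow_eigenvector) (rule op_proj)

lemma eigenvector_eq_0:
  assumes "T v = scale c v" "\<And>n. n \<le> d \<Longrightarrow> c \<noteq> th n"
  shows "v = 0"
proof -
  have "poly (\<Prod>n\<le>d. [:- th n, 1:]) c \<noteq> 0"
    using assms(2) by (auto simp: poly_prod)
  moreover have "scale (poly (\<Prod>n\<le>d. [:- th n, 1:]) c) v = 0"
    using op_poly_eigenvector[OF assms(1)] annihilated by metis
  ultimately show ?thesis by simp
qed

lemma proj_0_eigenvector:
  assumes "T v = scale c v" "c \<noteq> th n" "n \<le> d"
  shows "proj n v = 0"
proof -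
  have "scale (th n) (proj n v) = scale c (proj n v)"
    using proj_op[OF assms(3), of v] unfolding assms(1) proj.op_scale by (rule sym)
  thus ?thesis using assms(2) by (auto)
qed

lemma linear_eq_on_proj:
  assumes "linear_operator scale f" "linear_operator scale g"
    and "\<And>n. n \<le> d \<Longrightarrow> f (proj n v) = g (proj n v)"
  shows "f v = g v"
proof -
  interpret f: linear_operator scale f by (rule assms)
  interpret g: linear_operator scale g by (rule assms)
  have "f (\<Sum>n\<le>d. proj n v) = g (\<Sum>n\<le>d. proj n v)"
    unfolding f.op_sum g.op_sum using assms(3) by (intro sum.cong) auto
  thus ?thesis by (simp add: sum_proj)
qed

end

section \<open>Pairs of operators satisfying the cubic Serre relations\<close>

definition q_serre :: "('f::field \<Rightarrow> 'v::ab_group_add \<Rightarrow> 'v) \<Rightarrow> 'f \<Rightarrow> ('v \<Rightarrow> 'v) \<Rightarrow> ('v \<Rightarrow> 'v) \<Rightarrow> bool" where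
  "q_serre scale q S T \<longleftrightarrow>
     (\<forall>v. S (S (S (T v))) - scale (q_bracket3 q) (S (S (T (S v))))
        + scale (q_bracket3 q) (S (T (S (S v)))) - T (S (S (S v))) = 0)"

locale q_serre_pair =
  A: q_geometric_operator scale A q d + B: q_geometric_operator scale B q d
  for scale :: "'f::field \<Rightarrow> 'v::ab_group_add \<Rightarrow> 'v" and A B :: "'v \<Rightarrow> 'v" and q :: 'f and d :: nat +
  assumes serre_AB: "q_serre scale q A B" and serre_BA: "q_serre scale q B A"
begin

abbreviation th :: "nat \<Rightarrow> 'f" where "th \<equiv> q_geometric q d"

lemma swapped: "q_serre_pair scale B A q d"
  using serre_AB serre_BA by unfold_locales

text \<open>
  The Serre cubic of an eigenvector for \<open>th b\<close> does not vanish at \<open>th a\<close> as soon as \<open>th a\<close> is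
  neither \<open>th b\<close> nor one of its neighbours, so the component of \<open>B v\<close> there has to vanish.
\<close>

lemma tridiagonal:
  assumes "a \<le> d" "b \<le> d" "a > b + 1 \<or> b > a + 1"
  shows "A.proj a (B (A.proj b v)) = 0"
proof -
  define t where "t = th b"
  define c where "c = [:- (t ^ 3), q_bracket3 q * t ^ 2, - (q_bracket3 q * t), 1:]"
  have "0 = A (A (A (B (A.proj b v)))) - scale (q_bracket3 q) (A (A (B (A (A.proj b v)))))
        + scale (q_bracket3 q) (A (B (A (A (A.proj b v))))) - B (A (A (A (A.proj b v))))"
    using serre_AB unfolding q_serre_def by metis
  also have "\<dots> = A.op_poly c (B (A.proj b v))"
    using A.op_proj[OF assms(2)]
    by (simp add: c_def A.op_poly_pCons A.op_zero t_def A.op_scale B.op_scale A.op_add A.op_diff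
        power2_eq_square power3_eq_cube mult_ac)
  finally have "A.op_poly c (B (A.proj b v)) = 0" by simp
  hence "scale (poly c (th a)) (A.proj a (B (A.proj b v))) = 0"
    using A.proj_op_poly[OF assms(1)] A.proj.op_zero by metis
  moreover have "poly c (th a) \<noteq> 0"
  proof -
    have "th a - q powi (2 * k) * t \<noteq> 0" if "k \<in> {-1, 0, 1}" for k :: int
      using assms(3) that A.q_geometric_eq_shift_iff[of d a k b] by (auto simp: t_def)
    hence "(\<Prod>k\<in>{-1, 0, 1::int}. th a - q powi (2 * k) * t) \<noteq> 0"
      by (subst prod_zero_iff) blast+
    also have "(\<Prod>k\<in>{-1, 0, 1::int}. th a - q powi (2 * k) * t) = poly c (th a)"
      unfolding c_def A.serre_cubic_factorization poly_prod by (intro prod.cong) simp_all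
    finally show ?thesis .
  qed
  ultimately show ?thesis by simp
qed

lemma band:
  assumes "a \<le> d" "b \<le> d" "a > b + m \<or> b > a + m"
  shows "A.proj a ((B ^^ m) (A.proj b v)) = 0"
  using assms(1,3)
proof (induction m arbitrary: a)
  case 0
  thus ?case using A.proj_eigenvector[OF A.op_proj[OF assms(2)] assms(2)] by auto
next
  case (Suc m)
  let ?w = "(B ^^ m) (A.proj b v)"
  have "A.proj a (B (A.proj c ?w)) = 0" if "c \<le> d" for c
  proof (cases "a > c + 1 \<or> c > a + 1")
    case True
    thus ?thesis using tridiagonal Suc.prems that by blast
  next
    case False
    hence "A.proj c ?w = 0" using Suc that by (intro Suc.IH) auto
    thus ?thesis by (simp add: B.op_zero A.proj.op_zero)
  qed
  hence "A.proj a (B (\<Sum>c\<le>d. A.proj c ?w)) = 0"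
    by (simp add: B.op_sum A.proj.op_sum)
  thus ?case by (simp add: A.sum_proj)
qed

lemma band_poly:
  assumes "a \<le> d" "b \<le> d" "a > b + degree p \<or> b > a + degree p"
  shows "A.proj a (B.op_poly p (A.proj b v)) = 0"
proof -
  have "B.op_poly p (A.proj b v) =
      (\<Sum>k<Suc (degree p). scale (coeff p k) ((B ^^ k) (A.proj b v)))"
    by (rule B.op_poly_eq_sum) (auto simp: coeff_eq_0)
  moreover have "A.proj a ((B ^^ k) (A.proj b v)) = 0" if "k \<le> degree p" for k
    using assms that by (intro band) auto
  ultimately show ?thesis
    by (simp add: A.proj.op_sum A.proj.op_scale A.proj.op_add del: sum.lessThan_Suc)
qed

text \<open>
  Between the eigenspaces of \<open>A\<close> for \<open>th b\<close> and \<open>th a\<close> the word \<open>A\<^sup>k B\<^sup>m A\<^sup>N\<^sup>-\<^sup>k\<close> is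
  \<open>th a ^ k * th b ^ (N - k)\<close> times the corresponding block of \<open>B\<^sup>m\<close>, and that block is zero unless
  \<open>\<bar>a - b\<bar> \<le> m\<close>. Up to a power of \<open>q\<close> that depends only on \<open>k\<close> and \<open>m\<close> and a factor that depends
  only on \<open>b\<close>, this scalar is the monomial of degree \<open>b - a + m \<le> 2 m\<close> at the node \<open>q ^ (2 * k)\<close>.
  So Lagrange interpolation at any \<open>2 m + 1\<close> of these nodes gives coefficients that work for all the
  blocks at once.
\<close>

lemma exchange:
  assumes I: "I \<subseteq> {..N}" "card I = 2 * m + 1" and i: "i \<le> N"
  shows "\<exists>c. \<forall>v. (A ^^ i) ((B ^^ m) ((A ^^ (N - i)) v)) =
           (\<Sum>k\<in>I. scale (c k) ((A ^^ k) ((B ^^ m) ((A ^^ (N - k)) v))))"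
proof -
  have fin: "finite I" using I(1) finite_subset by blast
  define y where "y k = q ^ (2 * k)" for k
  have inj: "inj_on y I"
    using A.q_powi_eq_iff[of "int (2 * k)" "int (2 * l)" for k l]
    by (auto simp: inj_on_def y_def power_int_of_nat simp del: of_nat_mult)
  define c where "c k = poly (lagrange_poly y I k) (y i) * q ^ (2 * m * k) / q ^ (2 * m * i)" for k
  have shift: "th a ^ k * th b ^ (N - k) * q ^ (2 * m * k) = th b ^ N * y k ^ s"
    if "k \<le> N" "int s = int b - int a + int m" for a b k s
  proof -
    have powi: "th c * q ^ (2 * l) = q powi (int d - 2 * int c + int (2 * l))" for c l
      using A.q_nonzero by (simp add: q_geometric_def power_int_add del: of_nat_mult)
    have "int d - 2 * int a + int (2 * m) = int d - 2 * int b + int (2 * s)"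
      using that(2) by simp
    hence "th a * q ^ (2 * m) = th b * q ^ (2 * s)" unfolding powi by (rule arg_cong)
    hence "(th a * q ^ (2 * m)) ^ k = (th b * q ^ (2 * s)) ^ k" by simp
    hence "th a ^ k * q ^ (2 * m * k) = th b ^ k * y k ^ s"
      by (simp add: y_def power_mult_distrib mult_ac flip: power_mult)
    moreover have "th b ^ N = th b ^ k * th b ^ (N - k)"
      using that(1) by (simp flip: power_add)
    ultimately show ?thesis by (simp add: mult_ac)
  qed
  have coeffs: "(\<Sum>k\<in>I. c k * (th a ^ k * th b ^ (N - k))) = th a ^ i * th b ^ (N - i)"
    if ab: "\<not> (a > b + m \<or> b > a + m)" for a b
  proof -
    define s where "s = nat (int b - int a + int m)"
    have s: "int s = int b - int a + int m" "s \<le> 2 * m" using ab by (auto simp: s_def)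
    have "(\<Sum>k\<in>I. smult (poly (monom 1 s) (y k)) (lagrange_poly y I k)) = monom 1 s"
      using s(2) I(2) by (intro lagrange_interpolation fin inj) (simp add: degree_monom_eq)
    hence "poly (\<Sum>k\<in>I. smult (poly (monom 1 s) (y k)) (lagrange_poly y I k)) (y i) = y i ^ s"
      by (simp add: poly_monom)
    hence lag: "(\<Sum>k\<in>I. y k ^ s * poly (lagrange_poly y I k) (y i)) = y i ^ s"
      by (simp add: poly_sum poly_monom)
    have "(\<Sum>k\<in>I. c k * (th a ^ k * th b ^ (N - k))) * q ^ (2 * m * i) =
        (\<Sum>k\<in>I. poly (lagrange_poly y I k) (y i) * (th a ^ k * th b ^ (N - k) * q ^ (2 * m * k)))"
      unfolding sum_distrib_right using A.q_nonzero by (intro sum.cong) (simp_all add: c_def)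
    also have "\<dots> = (\<Sum>k\<in>I. poly (lagrange_poly y I k) (y i) * (th b ^ N * y k ^ s))"
      using I(1) shift[OF _ s(1)] by (intro sum.cong) auto
    also have "\<dots> = th b ^ N * (\<Sum>k\<in>I. y k ^ s * poly (lagrange_poly y I k) (y i))"
      by (simp add: sum_distrib_left mult_ac)
    also have "\<dots> = th a ^ i * th b ^ (N - i) * q ^ (2 * m * i)"
      using lag shift[OF i s(1)] by simp
    finally show ?thesis using A.q_nonzero by simp
  qed
  have expand: "(A ^^ k) ((B ^^ m) ((A ^^ l) v)) =
      (\<Sum>a\<le>d. \<Sum>b\<le>d. scale (th a ^ k * th b ^ l) (A.proj a ((B ^^ m) (A.proj b v))))" for k l v
  proof -
    interpret Ak: linear_operator scale "A ^^ k" by (rule A.linear_operator_funpow)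
    interpret Al: linear_operator scale "A ^^ l" by (rule A.linear_operator_funpow)
    interpret Bm: linear_operator scale "B ^^ m" by (rule B.linear_operator_funpow)
    have "(B ^^ m) ((A ^^ l) v) = (B ^^ m) ((A ^^ l) (\<Sum>b\<le>d. A.proj b v))"
      by (simp add: A.sum_proj)
    also have "\<dots> = (\<Sum>b\<le>d. scale (th b ^ l) ((B ^^ m) (A.proj b v)))"
      by (simp add: Al.op_sum Bm.op_sum Bm.op_scale A.funpow_proj)
    finally have inner: "(B ^^ m) ((A ^^ l) v) = \<dots>" .
    have "(A ^^ k) w = (\<Sum>a\<le>d. scale (th a ^ k) (A.proj a w))" for w
    proof -
      have "(A ^^ k) w = (A ^^ k) (\<Sum>a\<le>d. A.proj a w)" by (simp add: A.sum_proj)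
      thus ?thesis by (simp add: Ak.op_sum A.funpow_proj)
    qed
    thus ?thesis unfolding inner by (simp add: A.proj.op_sum A.proj.op_scale A.scale_sum_right)
  qed
  have "(A ^^ i) ((B ^^ m) ((A ^^ (N - i)) v)) =
           (\<Sum>k\<in>I. scale (c k) ((A ^^ k) ((B ^^ m) ((A ^^ (N - k)) v))))" for v
  proof -
    have "(\<Sum>k\<in>I. scale (c k) ((A ^^ k) ((B ^^ m) ((A ^^ (N - k)) v)))) =
        (\<Sum>a\<le>d. \<Sum>b\<le>d. scale (\<Sum>k\<in>I. c k * (th a ^ k * th b ^ (N - k)))
           (A.proj a ((B ^^ m) (A.proj b v))))"
      unfolding expand A.scale_sum_right A.scale_sum_left A.scale_scale
      by (subst sum.swap, rule sum.cong[OF refl], subst sum.swap) simp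
    also have "\<dots> = (\<Sum>a\<le>d. \<Sum>b\<le>d. scale (th a ^ i * th b ^ (N - i))
           (A.proj a ((B ^^ m) (A.proj b v))))"
    proof (intro sum.cong refl)
      fix a b assume "a \<in> {..d}" "b \<in> {..d}"
      thus "scale (\<Sum>k\<in>I. c k * (th a ^ k * th b ^ (N - k))) (A.proj a ((B ^^ m) (A.proj b v))) =
          scale (th a ^ i * th b ^ (N - i)) (A.proj a ((B ^^ m) (A.proj b v)))"
        using coeffs[of b a] band[of a b m v] by (cases "a > b + m \<or> b > a + m") auto
    qed
    finally show ?thesis by (simp add: expand)
  qed
  thus ?thesis by blast
qed

end

section \<open>Words starting and ending in an extremal eigenspace\<close>

context q_serre_pair
begin

text \<open>
  A word is stored as the list of exponents of its alternating blocks, because the flattening of a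
  word is driven by comparing neighbouring exponents. Exponents may be zero, so that every product of
  copies of \<open>A\<close> and \<open>B\<close> arises from a list whose first block belongs to \<open>A\<close>.
\<close>

primrec word :: "bool \<Rightarrow> nat list \<Rightarrow> 'v \<Rightarrow> 'v" where
  "word b [] v = v"
| "word b (i # is) v = ((if b then A else B) ^^ i) (word (\<not> b) is v)"

lemma word_append: "word b (is @ js) v = word b is (word (b = even (length is)) js v)"
  by (induction "is" arbitrary: b) (auto simp del: funpow.simps)

sublocale word: linear_operator scale "word b is" for b "is"
proof (induction "is" arbitrary: b)
  case Nil
  show ?case by unfold_locales simp_all
next
  case (Cons i "is")
  interpret w: linear_operator scale "word (\<not> b) is" by (rule Cons)
  interpret f: linear_operator scale "(if b then A else B) ^^ i"
    by (cases b) (simp_all add: A.linear_operator_funpow B.linear_operator_funpow)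
  show ?case by unfold_locales (simp_all add: w.op_add w.op_scale f.op_add f.op_scale)
qed

text \<open>
  By tridiagonality \<open>B.proj 0\<close> after \<open>A\<^sup>a\<close> only sees the eigenspaces of \<open>B\<close> with index at most \<open>a\<close>,
  and a polynomial vanishing at \<open>th 1, \<dots>, th k\<close> kills all of these but the top one.
\<close>

lemma absorb_left:
  assumes "a \<le> k" "\<And>n. 1 \<le> n \<Longrightarrow> n \<le> k \<Longrightarrow> poly p (th n) = 0"
  shows "B.proj 0 ((A ^^ a) (B.op_poly p v)) =
    scale (poly p (th 0)) (B.proj 0 ((A ^^ a) (B.proj 0 v)))"
proof -
  interpret Aa: linear_operator scale "A ^^ a" by (rule A.linear_operator_funpow)
  interpret p: linear_operator scale "B.op_poly p" by (rule B.linear_operator_op_poly)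
  interpret swap: q_serre_pair scale B A q d by (rule swapped)
  have "B.proj 0 ((A ^^ a) (B.op_poly p v)) =
      (\<Sum>n\<le>d. B.proj 0 ((A ^^ a) (B.op_poly p (B.proj n v))))"
    by (simp add: B.sum_proj flip: p.op_sum Aa.op_sum B.proj.op_sum)
  also have "\<dots> = (\<Sum>n\<le>d. if n = 0 then
      scale (poly p (th 0)) (B.proj 0 ((A ^^ a) (B.proj 0 v))) else 0)"
  proof (intro sum.cong refl)
    fix n assume n: "n \<in> {..d}"
    show "B.proj 0 ((A ^^ a) (B.op_poly p (B.proj n v))) =
      (if n = 0 then scale (poly p (th 0)) (B.proj 0 ((A ^^ a) (B.proj 0 v))) else 0)"
    proof (cases "n \<le> k")
      case True
      thus ?thesis using n assms(2)[of n]
        by (auto simp: B.op_poly_proj Aa.op_scale B.proj.op_scale)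
    next
      case False
      thus ?thesis using n assms(1) swap.band[of 0 n a v]
        by (auto simp: B.op_poly_proj Aa.op_scale B.proj.op_scale)
    qed
  qed
  finally show ?thesis by simp
qed

text \<open>
  The mirror image of \<open>absorb_left\<close>: \<open>A\<^sup>c u\<close> has no components beyond the index \<open>c\<close>.
\<close>

lemma absorb_right:
  assumes "c \<le> k" "\<And>n. 1 \<le> n \<Longrightarrow> n \<le> k \<Longrightarrow> poly p (th n) = 0" "B u = scale (th 0) u"
  shows "B.op_poly p ((A ^^ c) u) = scale (poly p (th 0)) (B.proj 0 ((A ^^ c) u))"
proof -
  interpret swap: q_serre_pair scale B A q d by (rule swapped)
  interpret p: linear_operator scale "B.op_poly p" by (rule B.linear_operator_op_poly)
  have u: "B.proj 0 u = u" using B.proj_eigenvector[OF assms(3)] by simp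
  have "B.op_poly p ((A ^^ c) u) = (\<Sum>n\<le>d. B.op_poly p (B.proj n ((A ^^ c) u)))"
    by (simp add: B.sum_proj flip: p.op_sum)
  also have "\<dots> = (\<Sum>n\<le>d. if n = 0 then
      scale (poly p (th 0)) (B.proj 0 ((A ^^ c) u)) else 0)"
  proof (intro sum.cong refl)
    fix n assume n: "n \<in> {..d}"
    show "B.op_poly p (B.proj n ((A ^^ c) u)) =
        (if n = 0 then scale (poly p (th 0)) (B.proj 0 ((A ^^ c) u)) else 0)"
    proof (cases "n \<le> k")
      case True
      thus ?thesis using n assms(2)[of n] by (auto simp: B.op_poly_proj)
    next
      case False
      thus ?thesis using n assms(1) swap.band[of n 0 c u] by (auto simp: u p.op_zero)
    qed
  qed
  finally show ?thesis by simp
qed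

lemma exchange_word:
  assumes "I \<subseteq> {..i + k}" "card I = 2 * m + 1"
  shows "\<exists>c. \<forall>v. word b (xs @ i # m # k # ys) v =
           (\<Sum>l\<in>I. scale (c l) (word b (xs @ l # m # (i + k - l) # ys) v))"
proof -
  interpret swap: q_serre_pair scale B A q d by (rule swapped)
  define b' where "b' = (b = even (length xs))"
  have "\<exists>c. \<forall>v. word b' [i, m, k] v = (\<Sum>l\<in>I. scale (c l) (word b' [l, m, i + k - l] v))"
    using exchange[OF assms, of i] swap.exchange[OF assms, of i] by (cases b') simp_all
  then obtain c where
    c: "word b' [i, m, k] v = (\<Sum>l\<in>I. scale (c l) (word b' [l, m, i + k - l] v))" for v
    by blast
  have "word b (xs @ i # m # k # ys) v =
           (\<Sum>l\<in>I. scale (c l) (word b (xs @ l # m # (i + k - l) # ys) v))" for v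
  proof -
    have split: "word b (xs @ l # m # l' # ys) v =
        word b xs (word b' [l, m, l'] (word (\<not> b') ys v))" for l l'
      by (simp add: word_append b'_def)
    show ?thesis unfolding split c word.op_sum word.op_scale ..
  qed
  thus ?thesis by blast
qed

text \<open>
  The number of entries after the last occurrence of the minimum: the final component of the measure
  for the induction below.
\<close>

definition last_min_distance :: "nat list \<Rightarrow> nat" where
  "last_min_distance is = length (takeWhile (\<lambda>i. Min (set is) < i) (rev is))"

lemma last_min_distance_append:
  assumes "Min (set (xs @ m # ys)) = m" "\<And>i. i \<in> set ys \<Longrightarrow> m < i"
  shows "last_min_distance (xs @ m # ys) = length ys"
  using assms by (simp add: last_min_distance_def takeWhile_append takeWhile_tail)

text \<open>
  A word with exponents \<open>i\<^sub>1, \<dots>, i\<^sub>s\<close> is treated by induction on its degree, then on its number of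
  blocks. If \<open>i\<^sub>1 \<le> i\<^sub>2\<close>, then the block \<open>B\<close> with exponent \<open>i\<^sub>2\<close> may be replaced, modulo words of
  lower degree, by a monic polynomial in \<open>B\<close> that acts there as a multiple of the projection; this
  cuts the word into two shorter ones. The same works at the end if \<open>i\<^sub>s \<le> i\<^sub>s\<^sub>-\<^sub>1\<close>. Otherwise the
  exponents start with a descent and end with an ascent, so that the last occurrence of the minimal
  exponent \<open>m\<close> lies in the interior, in a valley \<open>a \<ge> m < b\<close>. There \<open>exchange\<close> rewrites the pair
  \<open>(a, b)\<close> through pairs \<open>(a', b')\<close> of the same sum with \<open>a' < m\<close> or \<open>b' \<le> m\<close>: either the minimum
  drops, or it stays and its last occurrence moves to the right.
\<close>

theorem words_preserve_subspace:
  assumes U: "A.subspace U" "\<And>u. u \<in> U \<Longrightarrow> B u = scale (th 0) u"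
    and pres: "\<And>k u. u \<in> U \<Longrightarrow> B.proj 0 ((A ^^ k) u) \<in> U"
    and u: "u \<in> U"
  shows "B.proj 0 (word True is u) \<in> U"
  using u
proof (induction "is" arbitrary: u rule: wf_induct[OF wf_measures[of
      "[sum_list, length, \<lambda>is. Min (set is), last_min_distance]"]])
  case (1 "is" u)
  note \<open>u \<in> U\<close>
  have IH: "B.proj 0 (word True js u') \<in> U"
    if "(js, is) \<in> measures [sum_list, length, \<lambda>is. Min (set is), last_min_distance]" "u' \<in> U"
    for js u'
    using 1 that by blast
  have e_u: "B.proj 0 u' = u'" if "u' \<in> U" for u'
    using B.proj_eigenvector[OF U(2)[OF that]] by simp
  \<comment> \<open>The roots of \<open>p k\<close> are \<open>th 1, \<dots>, th k\<close>; the root \<open>th 0\<close> is left out on purpose.\<close>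
  define p where "p k = newton_poly (\<lambda>n. th (Suc n)) k" for k
  have p: "degree (p k) = k" "coeff (p k) k = 1" for k
    by (simp_all add: p_def monic_newton_poly)
  have p_root: "poly (p k) (th n) = 0" if "1 \<le> n" "n \<le> k" for n k
    using poly_newton_poly_eq_0[of "n - 1" k "\<lambda>n. th (Suc n)"] that by (simp add: p_def)
  \<comment> \<open>A list of even length ends in a power of \<open>B\<close>, which acts on \<open>u\<close> as a scalar. In a list of odd
    length at least 3 either one of the two ends can be absorbed, or there is a valley.\<close>
  consider "is = []" | j where "is = [j]"
    | js j where "is = js @ [j]" "odd (length js)"
    | i j js where "is = i # j # js" "i \<le> j"
    | js i j where "is = js @ [i, j]" "j \<le> i" "odd (length js)"
    | (valley) i j js ks k l where "is = i # j # js" "j < i" "is = ks @ [k, l]" "k < l"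
  proof -
    have "False" if no: "is \<noteq> []" "\<And>j. is \<noteq> [j]" "\<And>js j. is = js @ [j] \<Longrightarrow> even (length js)"
      "\<And>i j js. is = i # j # js \<Longrightarrow> j < i" "\<And>js i j. is = js @ [i, j] \<Longrightarrow> odd (length js) \<Longrightarrow> i < j"
      "\<And>i j js ks k l. is = i # j # js \<Longrightarrow> j < i \<Longrightarrow> is = ks @ [k, l] \<Longrightarrow> \<not> k < l"
    proof -
      obtain i j js where ij: "is = i # j # js" using no(1,2) by (metis list.exhaust)
      obtain js' l where l: "is = js' @ [l]" using no(1) by (metis rev_exhaust)
      obtain ks k where k: "js' = ks @ [k]" using no(2) l by (metis append_Nil rev_exhaust)
      have "even (length js')" using no(3) l by blast
      hence "odd (length ks)" using k by simp
      thus False using no(4)[OF ij] no(5)[of ks k l] no(6)[OF ij, of ks k l] l k by simp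
    qed
    thus ?thesis using that by (metis not_less)
  qed
  thus ?case
  proof cases
    case 1
    thus ?thesis using \<open>u \<in> U\<close> by (simp add: e_u)
  next
    case (2 j)
    thus ?thesis using \<open>u \<in> U\<close> pres by simp
  next
    case (3 js j)
    have "B.proj 0 (word True js u) \<in> U"
      using 3 \<open>u \<in> U\<close> by (intro IH) auto
    thus ?thesis
      using 3 B.funpow_eigenvector[OF U(2)[OF \<open>u \<in> U\<close>]]
      by (simp add: word_append word.op_scale B.proj.op_scale A.subspace_scale[OF U(1)]
          del: funpow.simps)
  next
    case (4 i j js)
    interpret Ai: linear_operator scale "A ^^ i" by (rule A.linear_operator_funpow)
    let ?w = "word True js u"
    have "B.proj 0 ?w \<in> U" using 4 \<open>u \<in> U\<close> by (intro IH) auto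
    hence "scale (poly (p j) (th 0)) (B.proj 0 ((A ^^ i) (B.proj 0 ?w))) \<in> U"
      by (intro A.subspace_scale[OF U(1)] pres)
    hence main: "B.proj 0 ((A ^^ i) (B.op_poly (p j) ?w)) \<in> U"
      using absorb_left[OF 4(2), of "p j" ?w] p_root by simp
    have "B.proj 0 (word True (i # k # js) u) \<in> U" if "k < j" for k
      using 4 that \<open>u \<in> U\<close> by (intro IH) auto
    hence lower: "(\<Sum>k<j. scale (coeff (p j) k) (B.proj 0 ((A ^^ i) ((B ^^ k) ?w)))) \<in> U"
      by (intro A.subspace_sum[OF U(1)] A.subspace_scale[OF U(1)]) auto
    have "B.proj 0 (word True is u) = B.proj 0 ((A ^^ i) ((B ^^ j) ?w))"
      using 4 by simp
    also have "\<dots> = B.proj 0 ((A ^^ i) (B.op_poly (p j) ?w)) -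
        (\<Sum>k<j. scale (coeff (p j) k) (B.proj 0 ((A ^^ i) ((B ^^ k) ?w))))"
      unfolding B.funpow_eq_monic_poly[OF p, of j ?w]
      by (simp add: Ai.op_diff Ai.op_sum Ai.op_scale B.proj.op_diff B.proj.op_sum B.proj.op_scale)
    finally show ?thesis using A.subspace_diff[OF U(1) main lower] by (simp only:)
  next
    case (5 js i j)
    let ?w = "(A ^^ j) u"
    have "B.proj 0 ?w \<in> U" using pres \<open>u \<in> U\<close> .
    hence "B.proj 0 (word True js (B.proj 0 ?w)) \<in> U" using 5 by (intro IH) auto
    hence main: "B.proj 0 (word True js (B.op_poly (p i) ?w)) \<in> U"
      using absorb_right[OF 5(2), of "p i" u] p_root U(2)[OF \<open>u \<in> U\<close>]
      by (simp add: word.op_scale B.proj.op_scale A.subspace_scale[OF U(1)])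
    have "B.proj 0 (word True (js @ [k, j]) u) \<in> U" if "k < i" for k
      using 5 that \<open>u \<in> U\<close> by (intro IH) auto
    hence lower: "(\<Sum>k<i. scale (coeff (p i) k) (B.proj 0 (word True js ((B ^^ k) ?w)))) \<in> U"
      using 5(3) by (intro A.subspace_sum[OF U(1)] A.subspace_scale[OF U(1)])
        (auto simp: word_append)
    have "B.proj 0 (word True is u) = B.proj 0 (word True js ((B ^^ i) ?w))"
      using 5 by (simp add: word_append)
    also have "\<dots> = B.proj 0 (word True js (B.op_poly (p i) ?w)) -
        (\<Sum>k<i. scale (coeff (p i) k) (B.proj 0 (word True js ((B ^^ k) ?w))))"
      unfolding B.funpow_eq_monic_poly[OF p, of i ?w]
      by (simp add: word.op_diff word.op_sum word.op_scale
          B.proj.op_diff B.proj.op_sum B.proj.op_scale)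
    finally show ?thesis using A.subspace_diff[OF U(1) main lower] by (simp only:)
  next
    case (valley i j js ks k l)
    define m where "m = Min (set is)"
    have ne: "is \<noteq> []" using valley by auto
    have m_le: "m \<le> n" if "n \<in> set is" for n using that by (simp add: m_def)
    have "m \<in> set is" using ne by (simp add: m_def)
    then obtain xs ys where xy: "is = xs @ m # ys" "m \<notin> set ys" by (metis split_list_last)
    have ys: "m < n" if "n \<in> set ys" for n
      using m_le[of n] that xy by (metis Un_iff le_neq_implies_less list.set_intros(2) set_append)
    have "xs \<noteq> []" using xy valley(1,2) m_le[of j] by auto
    then obtain xs' a where xs: "xs = xs' @ [a]" by (metis rev_exhaust)
    have "ys \<noteq> []"
    proof
      assume "ys = []"
      hence "m = l" using xy valley(3) by (metis append.right_neutral last_ConsL last_appendR last.simps not_Cons_self2 append_is_Nil_conv list.distinct(1))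
      thus False using m_le[of k] valley(3,4) by auto
    qed
    then obtain b ys' where b: "ys = b # ys'" by (metis list.exhaust)
    have is_eq: "is = xs' @ a # m # b # ys'" using xy xs b by simp
    have ab: "m \<le> a" "m < b" using m_le[of a] is_eq ys[of b] b by auto
    \<comment> \<open>The admissible first exponents \<open>n\<close>: either \<open>n < m\<close>, or the third exponent \<open>a + b - n\<close> is at
      most \<open>m\<close>. There are \<open>m + (m + 1)\<close> of them because \<open>a + b > 2 m\<close>.\<close>
    define I where "I = {..<m} \<union> {a + b - m..a + b}"
    have "card I = card {..<m} + card {a + b - m..a + b}"
      unfolding I_def using ab by (intro card_Un_disjoint) auto
    hence I: "I \<subseteq> {..a + b}" "card I = 2 * m + 1" using ab by (auto simp: I_def)
    obtain c where c: "word True is u =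
        (\<Sum>n\<in>I. scale (c n) (word True (xs' @ n # m # (a + b - n) # ys') u))"
      using exchange_word[OF I, of True xs' ys'] is_eq by blast
    have "B.proj 0 (word True (xs' @ n # m # (a + b - n) # ys') u) \<in> U" if "n \<in> I" for n
    proof (rule IH[OF _ \<open>u \<in> U\<close>])
      let ?js = "xs' @ n # m # (a + b - n) # ys'"
      have n: "n \<le> a + b" using that I by auto
      hence same: "sum_list ?js = sum_list is" "length ?js = length is" by (simp_all add: is_eq)
      have le: "Min (set ?js) \<le> m" by (rule Min_le) auto
      show "(?js, is) \<in> measures [sum_list, length, \<lambda>is. Min (set is), last_min_distance]"
      proof (cases "Min (set ?js) < m")
        case True
        thus ?thesis using same by (simp add: m_def)
      next
        case False
        hence eq: "Min (set ?js) = m" using le by simp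
        have "m \<le> n" "m \<le> a + b - n"
          using Min_le[of "set ?js" n] Min_le[of "set ?js" "a + b - n"] eq by auto
        hence "a + b - n = m" using that n by (auto simp: I_def)
        hence js: "?js = (xs' @ [n, m]) @ m # ys'" by simp
        have "last_min_distance ?js = length ys'"
          using eq ys b unfolding js by (intro last_min_distance_append) auto
        moreover have "Min (set (xs @ m # ys)) = m" by (simp flip: xy(1) m_def)
        hence "last_min_distance is = length ys"
          using last_min_distance_append[OF _ ys, of xs] xy(1) by simp
        ultimately show ?thesis using same eq b by (simp flip: m_def)
      qed
    qed
    thus ?thesis unfolding c
      by (simp add: B.proj.op_sum B.proj.op_scale A.subspace_sum[OF U(1)] A.subspace_scale[OF U(1)])
  qed
qed

end

section \<open>A symmetry between the two extremal eigenspaces\<close>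

context q_serre_pair
begin

text \<open>
  For \<open>j < k\<close> decompose \<open>y\<close> into eigenvectors of \<open>B\<close>: those with index below \<open>k\<close> are killed by the
  polynomial in \<open>B\<close>, and from those with index above \<open>j\<close> a polynomial of degree \<open>j\<close> in \<open>A\<close> does not
  reach the top eigenspace of \<open>B\<close>. For \<open>j > k\<close> decompose the image of \<open>y\<close> under the polynomial in
  \<open>B\<close> into eigenvectors of \<open>A\<close>: their indices are at most \<open>k\<close>, where the polynomial in \<open>A\<close> vanishes.
\<close>

lemma newton_poly_orthogonal:
  assumes y: "A y = scale (th 0) y" and "j \<noteq> k"
  shows "B.proj 0 (A.op_poly (newton_poly th j) (B.op_poly (newton_poly th k) y)) = 0"
proof -
  interpret swap: q_serre_pair scale B A q d by (rule swapped)
  interpret Aj: linear_operator scale "A.op_poly (newton_poly th j)"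
    by (rule A.linear_operator_op_poly)
  interpret Bk: linear_operator scale "B.op_poly (newton_poly th k)"
    by (rule B.linear_operator_op_poly)
  show ?thesis
  proof (cases "j < k")
    case True
    have "B.proj 0 (A.op_poly (newton_poly th j) (B.op_poly (newton_poly th k) (B.proj n y))) = 0"
      if "n \<le> d" for n
    proof (cases "n < k")
      case True
      thus ?thesis using that
        by (simp add: B.op_poly_proj poly_newton_poly_eq_0 Aj.op_zero B.proj.op_zero)
    next
      case False
      thus ?thesis using that \<open>j < k\<close> swap.band_poly[of 0 n "newton_poly th j" y]
        by (simp add: B.op_poly_proj Aj.op_scale B.proj.op_scale)
    qed
    hence "B.proj 0 (A.op_poly (newton_poly th j) (B.op_poly (newton_poly th k)
        (\<Sum>n\<le>d. B.proj n y))) = 0"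
      by (simp add: Bk.op_sum Aj.op_sum B.proj.op_sum)
    thus ?thesis by (simp add: B.sum_proj)
  next
    case False
    let ?w = "B.op_poly (newton_poly th k) y"
    have y0: "A.proj 0 y = y" using A.proj_eigenvector[OF y] by simp
    have "A.op_poly (newton_poly th j) (A.proj n ?w) = 0" if "n \<le> d" for n
    proof (cases "n < j")
      case True
      thus ?thesis using that by (simp add: A.op_poly_proj poly_newton_poly_eq_0)
    next
      case False
      hence "A.proj n (B.op_poly (newton_poly th k) (A.proj 0 y)) = 0"
        using that \<open>\<not> j < k\<close> \<open>j \<noteq> k\<close> by (intro band_poly) auto
      thus ?thesis by (simp add: y0 Aj.op_zero)
    qed
    hence "A.op_poly (newton_poly th j) (\<Sum>n\<le>d. A.proj n ?w) = 0"
      by (simp add: Aj.op_sum)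
    thus ?thesis by (simp add: A.sum_proj B.proj.op_zero)
  qed
qed

lemma proj_poly_symmetric:
  assumes y: "A y = scale (th 0) y"
  shows "B.proj 0 (A.op_poly f (B.op_poly g y)) = B.proj 0 (A.op_poly g (B.op_poly f y))"
proof -
  define Q where "Q f g = B.proj 0 (A.op_poly f (B.op_poly g y))" for f g
  interpret Ap: linear_operator scale "A.op_poly p" for p by (rule A.linear_operator_op_poly)
  have Q_linear: "Q 0 g = 0" "Q g 0 = 0" "Q (f + f') g = Q f g + Q f' g"
    "Q g (f + f') = Q g f + Q g f'"
    "Q (smult c f) g = scale c (Q f g)" "Q g (smult c f) = scale c (Q g f)" for f f' g c
    by (simp_all add: Q_def A.op_poly_add B.op_poly_add A.op_poly_smult B.op_poly_smult
        Ap.op_zero Ap.op_add Ap.op_scale B.proj.op_zero B.proj.op_add B.proj.op_scale)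
  have newton: "Q (newton_poly th j) (newton_poly th k) = Q (newton_poly th k) (newton_poly th j)" for j k
    using newton_poly_orthogonal[OF y, of j k] newton_poly_orthogonal[OF y, of k j]
    by (cases "j = k") (simp_all add: Q_def)
  have half: "Q (newton_poly th j) g = Q g (newton_poly th j)" for j g
    by (induction g rule: newton_poly_induct[where y = th]) (simp_all add: Q_linear newton)
  have "Q f g = Q g f"
    by (induction f rule: newton_poly_induct[where y = th]) (simp_all add: Q_linear half)
  thus ?thesis by (simp add: Q_def)
qed

text \<open>
  The symmetry for a monomial and the Lagrange polynomial that defines both projections.
\<close>

lemma proj_funpow_intertwine:
  assumes "A y = scale (th 0) y"
  shows "B.proj 0 ((A ^^ k) (B.proj 0 y)) = B.proj 0 (A.proj 0 ((B ^^ k) y))"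
  using proj_poly_symmetric[OF assms, of "monom 1 k" "lagrange_poly th {..d} 0"]
  by (simp add: A.op_poly_monom B.op_poly_monom A.proj_def B.proj_def)

text \<open>
  The smallest subspace that contains \<open>U\<close> and is closed under \<open>A\<close> and \<open>B\<close>; the description by words
  is the one to which \<open>words_preserve_subspace\<close> applies.
\<close>

definition word_span :: "'v set \<Rightarrow> 'v set" where
  "word_span U = A.span {word True is u | is u. u \<in> U}"

lemma subset_word_span: "U \<subseteq> word_span U"
proof
  fix u assume "u \<in> U"
  hence "word True [] u \<in> word_span U" unfolding word_span_def by (intro A.span_base) blast
  thus "u \<in> word_span U" by simp
qed

lemma subspace_word_span: "A.subspace (word_span U)"
  unfolding word_span_def by (rule A.subspace_span)

lemma word_span_closed:
  assumes "v \<in> word_span U"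
  shows "A v \<in> word_span U" "B v \<in> word_span U"
proof -
  have "A (word True is u) \<in> {word True is u | is u. u \<in> U}" if "u \<in> U" for "is" u
  proof (cases "is")
    case Nil
    hence "A (word True is u) = word True [1] u" by simp
    thus ?thesis using that by blast
  next
    case (Cons i js)
    hence "A (word True is u) = word True (Suc i # js) u" by simp
    thus ?thesis using that by blast
  qed
  moreover have "B (word True is u) \<in> {word True is u | is u. u \<in> U}" if "u \<in> U" for "is" u
  proof -
    have "B (word True is u) = word True (0 # 1 # is) u" by simp
    thus ?thesis using that by blast
  qed
  ultimately have "w \<in> {word True is u | is u. u \<in> U} \<Longrightarrow>
      A w \<in> word_span U \<and> B w \<in> word_span U" for w
    unfolding word_span_def using A.span_base by blast
  moreover have "A.subspace {w. A w \<in> word_span U \<and> B w \<in> word_span U}"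
    using subspace_word_span[of U]
    by (auto simp: A.subspace_def A.op_zero B.op_zero A.op_add B.op_add A.op_scale B.op_scale)
  ultimately have "A.span {word True is u | is u. u \<in> U} \<subseteq>
      {w. A w \<in> word_span U \<and> B w \<in> word_span U}"
    by (intro A.span_minimal) blast+
  thus "A v \<in> word_span U" "B v \<in> word_span U"
    using assms unfolding word_span_def by blast+
qed

lemma word_span_minimal:
  assumes "A.subspace N" "U \<subseteq> N" "\<And>v. v \<in> N \<Longrightarrow> A v \<in> N" "\<And>v. v \<in> N \<Longrightarrow> B v \<in> N"
  shows "word_span U \<subseteq> N"
proof -
  have "(A ^^ k) v \<in> N" "(B ^^ k) v \<in> N" if "v \<in> N" for k v
    using that by (induction k) (auto intro: assms(3,4))
  hence "word b is u \<in> N" if "u \<in> U" for b "is" u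
    using that assms(2) by (induction "is" arbitrary: b) auto
  thus ?thesis
    unfolding word_span_def using assms(1) by (intro A.span_minimal) blast+
qed

lemma proj_word_span:
  assumes U: "A.subspace U" "\<And>u. u \<in> U \<Longrightarrow> B u = scale (th 0) u"
    and pres: "\<And>k u. u \<in> U \<Longrightarrow> B.proj 0 ((A ^^ k) u) \<in> U"
    and "v \<in> word_span U"
  shows "B.proj 0 v \<in> U"
proof -
  have "A.subspace {w. B.proj 0 w \<in> U}"
    using U(1) by (auto simp: A.subspace_def B.proj.op_zero B.proj.op_add B.proj.op_scale)
  moreover have "{word True is u | is u. u \<in> U} \<subseteq> {w. B.proj 0 w \<in> U}"
    using words_preserve_subspace[OF U pres] by blast
  ultimately have "word_span U \<subseteq> {w. B.proj 0 w \<in> U}"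
    unfolding word_span_def by (rule A.span_minimal[rotated])
  thus ?thesis using assms(4) by blast
qed

end

section \<open>The \<open>q\<close>-Weyl relation\<close>

definition q_weyl :: "('f::field \<Rightarrow> 'v::ab_group_add \<Rightarrow> 'v) \<Rightarrow> 'f \<Rightarrow> ('v \<Rightarrow> 'v) \<Rightarrow> ('v \<Rightarrow> 'v) \<Rightarrow> bool" where
  "q_weyl scale q S T \<longleftrightarrow>
     (\<forall>v. scale q (S (T v)) - scale (inverse q) (T (S v)) = scale (q - inverse q) v)"

context linear_operator
begin

lemma linear_operator_compose:
  assumes "linear_operator scale S"
  shows "linear_operator scale (\<lambda>v. T (S v))"
proof -
  interpret S: linear_operator scale S by fact
  show ?thesis by unfold_locales (simp_all add: S.op_add S.op_scale op_add op_scale)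
qed

lemma linear_operator_scaled: "linear_operator scale (\<lambda>v. scale c (T v))"
  by unfold_locales (simp_all add: op_add op_scale scale_right_distrib mult.commute)

lemma q_weyl_left:
  assumes "q_weyl scale q T S" "q \<noteq> 0"
  shows "T (S v) = scale (inverse q ^ 2) (S (T v)) + scale (1 - inverse q ^ 2) v"
proof -
  have "scale q (T (S v)) = scale (inverse q) (S (T v)) + scale (q - inverse q) v"
    using assms(1) unfolding q_weyl_def by (metis diff_add_cancel add.commute)
  hence "scale (inverse q) (scale q (T (S v))) =
      scale (inverse q) (scale (inverse q) (S (T v)) + scale (q - inverse q) v)"
    by simp
  thus ?thesis
    using assms(2) by (simp add: scale_right_distrib power2_eq_square right_diff_distrib)
qed

lemma q_weyl_right:
  assumes "q_weyl scale q S T" "q \<noteq> 0"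
  shows "T (S v) = scale (q ^ 2) (S (T v)) + scale (1 - q ^ 2) v"
proof -
  have "scale (inverse q) (T (S v)) = scale q (S (T v)) - scale (q - inverse q) v"
    using assms(1) unfolding q_weyl_def by (metis add_diff_cancel_left' diff_add_cancel)
  hence "scale q (scale (inverse q) (T (S v))) =
      scale q (scale q (S (T v)) - scale (q - inverse q) v)"
    by simp
  thus ?thesis
    using assms(2)
    by (simp add: scale_right_diff_distrib power2_eq_square right_diff_distrib scale_left_diff_distrib)
qed

text \<open>
  The Weyl relation says \<open>(T - q\<^sup>2 c) (S - c\<^sup>-\<^sup>1) v = 0\<close> on an eigenvector of \<open>T\<close>: up to the scalar
  \<open>c\<^sup>-\<^sup>1\<close>, the operator \<open>S\<close> shifts the eigenvalue of \<open>T\<close> by the factor \<open>q\<^sup>2\<close>. In the opposite order of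
  \<open>S\<close> and \<open>T\<close> the factor is \<open>q\<^sup>-\<^sup>2\<close>.
\<close>

lemma q_weyl_eigenvector_right:
  assumes "q_weyl scale q S T" "q \<noteq> 0" "T v = scale c v" "c \<noteq> 0" "linear_operator scale S"
  shows "T (S v - scale (inverse c) v) = scale (q ^ 2 * c) (S v - scale (inverse c) v)"
proof -
  interpret S: linear_operator scale S by fact
  have "T (S v) = scale (q ^ 2 * c) (S v) + scale (1 - q ^ 2) v"
    using q_weyl_right[OF assms(1,2), of v] by (simp add: assms(3) S.op_scale)
  thus ?thesis using assms(3,4)
    by (simp add: op_diff op_scale scale_right_diff_distrib scale_left_diff_distrib)
qed

lemma q_weyl_eigenvector_left:
  assumes "q_weyl scale q T S" "q \<noteq> 0" "T v = scale c v" "c \<noteq> 0" "linear_operator scale S"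
  shows "T (S v - scale (inverse c) v) = scale (inverse q ^ 2 * c) (S v - scale (inverse c) v)"
proof -
  interpret S: linear_operator scale S by fact
  have "T (S v) = scale (inverse q ^ 2 * c) (S v) + scale (1 - inverse q ^ 2) v"
    using q_weyl_left[OF assms(1,2), of v] by (simp add: assms(3) S.op_scale)
  thus ?thesis using assms(3,4)
    by (simp add: op_diff op_scale scale_right_diff_distrib scale_left_diff_distrib)
qed

text \<open>
  Moving \<open>T\<close> to the left through \<open>S\<^sup>k\<close> costs only a multiple of \<open>S\<^sup>k\<^sup>-\<^sup>1\<close>. So the vectors whose whole
  \<open>S\<close>-orbit lies in \<open>M\<close> form a subspace that is again closed under \<open>T\<close>; if it contains generators
  of \<open>M\<close>, then \<open>M\<close> is closed under \<open>S\<close>.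
\<close>

lemma stable_part_closed:
  assumes "subspace M" "\<And>v. v \<in> M \<Longrightarrow> T v \<in> M"
    and comm: "\<And>v. S (T v) = scale a (T (S v)) + scale b v"
    and lin: "linear_operator scale S"
    and v: "\<And>k. (S ^^ k) v \<in> M"
  shows "(S ^^ k) (T v) \<in> M"
proof -
  interpret S: linear_operator scale S by fact
  \<comment> \<open>For \<open>k = 0\<close> the truncated exponent \<open>k - 1\<close> is harmless, as \<open>b = 0\<close> is possible.\<close>
  have "\<exists>a b. \<forall>v. (S ^^ k) (T v) = scale a (T ((S ^^ k) v)) + scale b ((S ^^ (k - 1)) v)"
  proof (induction k)
    case 0
    have "(S ^^ 0) (T v) = scale 1 (T ((S ^^ 0) v)) + scale 0 ((S ^^ (0 - 1)) v)" for v by simp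
    thus ?case by blast
  next
    case (Suc k)
    then obtain a' b' where
      IH: "(S ^^ k) (T v) = scale a' (T ((S ^^ k) v)) + scale b' ((S ^^ (k - 1)) v)" for v
      by blast
    have "(S ^^ Suc k) (T v) = scale (a' * a) (T ((S ^^ Suc k) v)) +
        scale (a' * b + b') ((S ^^ (Suc k - 1)) v)" if "k > 0" for v
    proof -
      have "S ((S ^^ (k - 1)) v) = (S ^^ k) v" using that by (cases k) auto
      thus ?thesis using that
        by (simp add: IH S.op_add S.op_scale comm scale_right_distrib scale_left_distrib)
    qed
    moreover have "(S ^^ Suc 0) (T v) = scale a (T ((S ^^ Suc 0) v)) +
        scale b ((S ^^ (Suc 0 - 1)) v)" for v
      by (simp add: comm)
    ultimately show ?case by (cases "k = 0") blast+
  qed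
  then obtain a b where
    "(S ^^ k) (T v) = scale a (T ((S ^^ k) v)) + scale b ((S ^^ (k - 1)) v)" by blast
  thus ?thesis using assms(1,2) v by (auto intro!: subspace_add subspace_scale)
qed

end

lemma (in q_not_root_of_unity) q_geometric_shifts:
  "q ^ 2 * q_geometric q d n = q_geometric q d m \<longleftrightarrow> int m + 1 = int n"
  "inverse q ^ 2 * q_geometric q d n = q_geometric q d m \<longleftrightarrow> int m = int n + 1"
proof -
  have powi: "q ^ 2 = q powi (2 * 1)" "inverse q ^ 2 = q powi (2 * (- 1))"
    by (simp_all add: power_int_minus power_inverse)
  show "q ^ 2 * q_geometric q d n = q_geometric q d m \<longleftrightarrow> int m + 1 = int n"
    unfolding powi by (rule trans[OF eq_commute q_geometric_eq_shift_iff])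
  have "inverse q ^ 2 * q_geometric q d n = q_geometric q d m \<longleftrightarrow> int m + (- 1) = int n"
    unfolding powi by (rule trans[OF eq_commute q_geometric_eq_shift_iff])
  thus "inverse q ^ 2 * q_geometric q d n = q_geometric q d m \<longleftrightarrow> int m = int n + 1"
    by (simp only: diff_conv_add_uminus[symmetric] diff_eq_eq)
qed

lemma (in q_not_root_of_unity) inverse_q_geometric:
  "n \<le> d \<Longrightarrow> inverse (q_geometric q d n) = q_geometric q d (d - n)"
  by (simp add: q_geometric_def of_nat_diff flip: power_int_minus)

text \<open>
  On an eigenvector of \<open>T\<close> the operator \<open>S\<close> raises the eigenvalue by \<open>q\<^sup>2\<close>, beyond \<open>th 0\<close> there is
  nothing left, and \<open>inverse (th n) = th (d - n)\<close>. Hence the top eigenspace of \<open>T\<close> is the bottom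
  eigenspace of \<open>S\<close>. Dually, the top projection of \<open>S\<close> and the bottom projection of \<open>T\<close> have the same
  kernel.
\<close>

locale q_weyl_pair =
  S: q_geometric_operator scale S q d + T: q_geometric_operator scale T q d
  for scale :: "'f::field \<Rightarrow> 'v::ab_group_add \<Rightarrow> 'v" and S T :: "'v \<Rightarrow> 'v" and q :: 'f and d :: nat +
  assumes weyl: "q_weyl scale q S T"
begin

abbreviation th :: "nat \<Rightarrow> 'f" where "th \<equiv> q_geometric q d"

lemma right_top_imp_left_bottom:
  assumes "T v = scale (th 0) v"
  shows "S v = scale (th d) v"
proof -
  have "S v - scale (inverse (th 0)) v = 0"
    using T.q_weyl_eigenvector_right[OF weyl S.q_nonzero assms _ S.linear_operator_axioms]
    by (rule T.eigenvector_eq_0) (use S.q_geometric_shifts(1)[of d 0] in auto)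
  thus ?thesis by (simp add: S.inverse_q_geometric)
qed

lemma left_bottom_imp_right_top:
  assumes "S v = scale (th d) v"
  shows "T v = scale (th 0) v"
proof -
  have "S (T v - scale (inverse (th d)) v) =
      scale (inverse q ^ 2 * th d) (T v - scale (inverse (th d)) v)"
    using S.q_weyl_eigenvector_left[OF weyl S.q_nonzero assms _ T.linear_operator_axioms] by simp
  hence "T v - scale (inverse (th d)) v = 0"
  proof (rule S.eigenvector_eq_0)
    fix n assume "n \<le> d"
    thus "inverse q ^ 2 * th d \<noteq> th n" using S.q_geometric_shifts(2)[of d d n] by linarith
  qed
  thus ?thesis by (simp add: S.inverse_q_geometric)
qed

lemma proj_left_top: "S.proj 0 (T v) = scale (th d) (S.proj 0 v)"
proof (rule S.linear_eq_on_proj[where f = "\<lambda>v. S.proj 0 (T v)" and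
      g = "\<lambda>v. scale (th d) (S.proj 0 v)"])
  show "linear_operator scale (\<lambda>v. S.proj 0 (T v))"
    "linear_operator scale (\<lambda>v. scale (th d) (S.proj 0 v))"
    by (rule S.proj.linear_operator_compose S.proj.linear_operator_scaled
        T.linear_operator_axioms)+
  fix n assume n: "n \<le> d"
  let ?v = "S.proj n v" and ?w = "T (S.proj n v) - scale (inverse (th n)) (S.proj n v)"
  have "S ?w = scale (inverse q ^ 2 * th n) ?w"
    using S.q_weyl_eigenvector_left[OF weyl S.q_nonzero S.op_proj[OF n] _ T.linear_operator_axioms]
    by simp
  hence "S.proj 0 ?w = 0"
    by (rule S.proj_0_eigenvector) (use S.q_geometric_shifts(2)[of d n 0] in auto)
  hence "S.proj 0 (T ?v) = scale (inverse (th n)) (S.proj 0 ?v)"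
    by (simp add: S.proj.op_diff S.proj.op_scale)
  thus "S.proj 0 (T ?v) = scale (th d) (S.proj 0 ?v)"
    using S.proj_eigenvector[OF S.op_proj[OF n] n, of 0]
    by (cases "n = 0") (simp_all add: S.inverse_q_geometric)
qed

lemma proj_right_bottom: "T.proj d (S v) = scale (th 0) (T.proj d v)"
proof (rule T.linear_eq_on_proj[where f = "\<lambda>v. T.proj d (S v)" and
      g = "\<lambda>v. scale (th 0) (T.proj d v)"])
  show "linear_operator scale (\<lambda>v. T.proj d (S v))"
    "linear_operator scale (\<lambda>v. scale (th 0) (T.proj d v))"
    by (rule T.proj.linear_operator_compose T.proj.linear_operator_scaled
        S.linear_operator_axioms)+
  fix n assume n: "n \<le> d"
  let ?v = "T.proj n v" and ?w = "S (T.proj n v) - scale (inverse (th n)) (T.proj n v)"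
  have "T ?w = scale (q ^ 2 * th n) ?w"
    using T.q_weyl_eigenvector_right[OF weyl S.q_nonzero T.op_proj[OF n] _ S.linear_operator_axioms]
    by simp
  hence "T.proj d ?w = 0"
    by (rule T.proj_0_eigenvector) (use n S.q_geometric_shifts(1)[of d n d] in auto)
  hence "T.proj d (S ?v) = scale (inverse (th n)) (T.proj d ?v)"
    by (simp add: T.proj.op_diff T.proj.op_scale)
  thus "T.proj d (S ?v) = scale (th 0) (T.proj d ?v)"
    using T.proj_eigenvector[OF T.op_proj[OF n] n, of d]
    by (cases "n = d") (simp_all add: S.inverse_q_geometric)
qed

lemma proj_left_right: "S.proj 0 (T.proj d v) = S.proj 0 v"
proof -
  have "S.proj 0 (T.op_poly p v) = scale (poly p (th d)) (S.proj 0 v)" for p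
    by (induction p) (simp_all add: T.op_poly_pCons S.proj.op_zero S.proj.op_add S.proj.op_scale
        proj_left_top S.scale_left_distrib)
  thus ?thesis by (simp add: T.proj_def poly_lagrange_poly S.inj_on_q_geometric)
qed

lemma proj_right_left: "T.proj d (S.proj 0 v) = T.proj d v"
proof -
  have "T.proj d (S.op_poly p v) = scale (poly p (th 0)) (T.proj d v)" for p
    by (induction p) (simp_all add: S.op_poly_pCons T.proj.op_zero T.proj.op_add T.proj.op_scale
        proj_right_bottom S.scale_left_distrib)
  thus ?thesis by (simp add: S.proj_def poly_lagrange_poly S.inj_on_q_geometric)
qed

end

section \<open>Four operators satisfying the relations of \<open>\<box>\<^sub>q\<close>\<close>

lemma four_add_four: "(i::4) + 2 + 2 = i" "(i::4) + 3 + 1 = i"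
  by (simp_all add: add.assoc)

lemma four_sums: "(1::4) + 2 = 3" "(3::4) + 2 = 1"
  by simp_all

lemma index_four_cases: "(j::4) = i \<or> j = i + 1 \<or> j = i + 2 \<or> j = i + 3"
proof -
  have "k = 0 \<or> k = 1 \<or> k = 2 \<or> k = 3" for k :: 4
  proof (cases k)
    case (of_int z)
    hence "z = 0 \<or> z = 1 \<or> z = 2 \<or> z = 3" by auto
    thus ?thesis using of_int(1) by auto
  qed
  from this[of "j - i"] show ?thesis by (auto simp: algebra_simps)
qed

locale box_operators =
  fixes scale :: "'f::field \<Rightarrow> 'v::ab_group_add \<Rightarrow> 'v" and q :: 'f and d :: nat
    and x :: "4 \<Rightarrow> 'v \<Rightarrow> 'v"
  assumes geometric: "q_geometric_operator scale (x i) q d"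
    and weyl: "q_weyl scale q (x i) (x (i + 1))"
    and serre: "q_serre scale q (x i) (x (i + 2))"
begin

sublocale x: q_geometric_operator scale "x i" q d for i
  by (rule geometric)

lemma weyl_pair: "j = i + 1 \<Longrightarrow> q_weyl_pair scale (x i) (x j) q d"
  by (intro q_weyl_pair.intro q_weyl_pair_axioms.intro geometric) (simp add: weyl)

lemma odd_serre_pair: "q_serre_pair scale (x 1) (x 3) q d"
proof -
  have "q_serre scale q (x 1) (x 3)" using serre[of 1] by simp
  moreover have "q_serre scale q (x 3) (x 1)" using serre[of 3] unfolding four_sums .
  ultimately show ?thesis by (intro q_serre_pair.intro q_serre_pair_axioms.intro geometric)
qed

abbreviation th :: "nat \<Rightarrow> 'f" where "th \<equiv> q_geometric q d"

lemma stable_part_closed_neighbour: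
  assumes "x.subspace M" "\<And>v. v \<in> M \<Longrightarrow> x j v \<in> M" "j = i + 1 \<or> i = j + 1"
    and v: "\<And>k. (x i ^^ k) v \<in> M"
  shows "(x i ^^ k) (x j v) \<in> M"
proof -
  have "\<exists>a b. \<forall>v. x i (x j v) = scale a (x j (x i v)) + scale b v"
    using assms(3)
  proof
    assume "j = i + 1"
    hence "q_weyl scale q (x i) (x j)" using weyl by simp
    thus ?thesis using x.q_weyl_left[OF _ x.q_nonzero] by blast
  next
    assume "i = j + 1"
    hence "q_weyl scale q (x j) (x i)" using weyl by simp
    thus ?thesis using x.q_weyl_right[OF _ x.q_nonzero] by blast
  qed
  then obtain a b where "x i (x j v) = scale a (x j (x i v)) + scale b v" for v by blast
  from x.stable_part_closed[OF assms(1,2) this x.linear_operator_axioms v] show ?thesis by blast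
qed

text \<open>
  The subspace \<open>M\<close> generated by \<open>U\<close> under \<open>x 1\<close> and \<open>x 3\<close> is closed under \<open>x 2\<close>, since \<open>x 2\<close> is a scalar
  on \<open>U\<close>. For \<open>x 0\<close> this argument starts elsewhere: \<open>x 0\<close> is a scalar on the image of \<open>U\<close> under the
  top projection of \<open>x 1\<close>, and the assumption \<open>returns\<close> says that \<open>U\<close>, and with it all of \<open>M\<close>, can be
  recovered from that image inside \<open>M\<close>.
\<close>

lemma generated_submodule:
  assumes U: "x.subspace U" "\<And>u. u \<in> U \<Longrightarrow> x 3 u = scale (th 0) u"
    and pres: "\<And>k u. u \<in> U \<Longrightarrow> x.proj 3 0 ((x 1 ^^ k) u) \<in> U"
    and returns: "U \<subseteq> x.proj 3 0 ` x.proj 1 0 ` U"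
  obtains M where "x.subspace M" "U \<subseteq> M" "\<And>i v. v \<in> M \<Longrightarrow> x i v \<in> M"
    "\<And>v. v \<in> M \<Longrightarrow> x.proj 3 0 v \<in> U"
proof -
  interpret T: q_serre_pair scale "x 1" "x 3" q d by (rule odd_serre_pair)
  define M where "M = T.word_span U"
  have M: "x.subspace M" "\<And>v. v \<in> M \<Longrightarrow> x 1 v \<in> M" "\<And>v. v \<in> M \<Longrightarrow> x 3 v \<in> M"
    by (simp_all add: M_def T.subspace_word_span T.word_span_closed)
  have UM: "U \<subseteq> M" unfolding M_def by (rule T.subset_word_span)
  have even_closed: "\<forall>v\<in>M. x i v \<in> M"
    if i: "1 = i + 1 \<or> i = 1 + 1" "3 = i + 1 \<or> i = 3 + 1" and N: "U \<subseteq> {v. \<forall>k. (x i ^^ k) v \<in> M}" for i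
  proof -
    let ?N = "{v. \<forall>k. (x i ^^ k) v \<in> M}"
    interpret p: linear_operator scale "x i ^^ k" for k by (rule x.linear_operator_funpow)
    have "x.subspace ?N"
      using M(1) by (auto simp: x.subspace_def p.op_zero p.op_add p.op_scale)
    moreover have "x 1 v \<in> ?N" "x 3 v \<in> ?N" if "v \<in> ?N" for v
      using stable_part_closed_neighbour[OF M(1,2) i(1)]
        stable_part_closed_neighbour[OF M(1,3) i(2)] that by blast+
    ultimately have "M \<subseteq> ?N"
      unfolding M_def using N by (intro T.word_span_minimal) (auto simp: M_def)
    hence "(x i ^^ 1) v \<in> M" if "v \<in> M" for v using that by blast
    thus ?thesis by simp
  qed
  have "\<forall>v\<in>M. x 2 v \<in> M"
  proof (rule even_closed)
    interpret w: q_weyl_pair scale "x 2" "x 3" q d by (rule weyl_pair) simp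
    show "U \<subseteq> {v. \<forall>k. (x 2 ^^ k) v \<in> M}"
    proof safe
      fix u k assume u: "u \<in> U"
      have "x 2 u = scale (th d) u" by (rule w.right_top_imp_left_bottom[OF U(2)[OF u]])
      thus "(x 2 ^^ k) u \<in> M"
        using x.funpow_eigenvector[of 2 u] x.subspace_scale[OF M(1)] u UM by fastforce
    qed
  qed simp_all
  moreover have "\<forall>v\<in>M. x 0 v \<in> M"
  proof (rule even_closed)
    interpret w: q_weyl_pair scale "x 0" "x 1" q d by (rule weyl_pair) simp
    let ?N = "{v. \<forall>k. (x 0 ^^ k) v \<in> M}"
    interpret p: linear_operator scale "x 0 ^^ k" for k by (rule x.linear_operator_funpow)
    have sub: "x.subspace ?N"
      using M(1) by (auto simp: x.subspace_def p.op_zero p.op_add p.op_scale)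
    have x3: "x 3 v \<in> ?N" if "v \<in> ?N" for v
      using stable_part_closed_neighbour[OF M(1,3), of 0] that by auto
    have P1: "x.proj 1 0 u \<in> ?N" if u: "u \<in> U" for u
    proof safe
      fix k
      have "x.proj 1 0 u \<in> M"
        unfolding x.proj_def by (rule x.op_poly_in_subspace) (use M UM u in auto)
      moreover have "x 0 (x.proj 1 0 u) = scale (th d) (x.proj 1 0 u)"
        by (rule w.right_top_imp_left_bottom) (simp add: x.op_proj)
      ultimately show "(x 0 ^^ k) (x.proj 1 0 u) \<in> M"
        using x.funpow_eigenvector[of 0 "x.proj 1 0 u"] x.subspace_scale[OF M(1)] by fastforce
    qed
    have "x.proj 3 0 v \<in> ?N" if "v \<in> ?N" for v
      unfolding x.proj_def by (rule x.op_poly_in_subspace[OF sub x3 that])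
    thus "U \<subseteq> ?N" using returns P1 by blast
  qed simp_all
  ultimately have "x i v \<in> M" if "v \<in> M" for i v
    using index_four_cases[of i 0] that M(2,3) by auto
  moreover have "x.proj 3 0 v \<in> U" if "v \<in> M" for v
    using T.proj_word_span[OF U pres] that unfolding M_def by blast
  ultimately show ?thesis using that M(1) UM by blast
qed

end

section \<open>Componentwise operators on a product\<close>

definition prod_scale :: "('f \<Rightarrow> 'v \<Rightarrow> 'v) \<Rightarrow> 'f \<Rightarrow> 'v \<times> 'v \<Rightarrow> 'v \<times> 'v" where
  "prod_scale scale c z = (scale c (fst z), scale c (snd z))"

lemma prod_scale_Pair [simp]: "prod_scale scale c (v, w) = (scale c v, scale c w)"
  by (simp add: prod_scale_def)

lemma (in vector_space) vector_space_prod_scale: "vector_space (prod_scale scale)"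
  by unfold_locales
     (auto simp: prod_scale_def scale_right_distrib scale_left_distrib plus_prod_def)

lemma linear_operator_map_prod:
  assumes "linear_operator scale S" "linear_operator scale T"
  shows "linear_operator (prod_scale scale) (map_prod S T)"
proof -
  interpret S: linear_operator scale S by fact
  interpret T: linear_operator scale T by fact
  interpret vector_space "prod_scale scale" by (rule S.vector_space_prod_scale)
  show ?thesis
    by unfold_locales
      (auto simp: S.op_add T.op_add S.op_scale T.op_scale plus_prod_def)
qed

lemma op_poly_map_prod:
  assumes "linear_operator scale S" "linear_operator scale T"
  shows "linear_operator.op_poly (prod_scale scale) (map_prod S T) p (v, w) =
    (linear_operator.op_poly scale S p v, linear_operator.op_poly scale T p w)"
proof -
  interpret S: linear_operator scale S by fact
  interpret T: linear_operator scale T by fact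
  interpret ST: linear_operator "prod_scale scale" "map_prod S T"
    by (rule linear_operator_map_prod[OF assms])
  show ?thesis
    by (induction p)
       (auto simp: ST.op_poly_pCons S.op_poly_pCons T.op_poly_pCons zero_prod_def)
qed

lemma funpow_map_prod:
  fixes S :: "'a \<Rightarrow> 'a" and T :: "'b \<Rightarrow> 'b"
  shows "(map_prod S T ^^ k) (v, w) = ((S ^^ k) v, (T ^^ k) w)"
  by (induction k) auto

lemma q_geometric_operator_map_prod:
  assumes "q_geometric_operator scale S q d" "q_geometric_operator scale T q d"
  shows "q_geometric_operator (prod_scale scale) (map_prod S T) q d"
proof -
  interpret S: q_geometric_operator scale S q d by fact
  interpret T: q_geometric_operator scale T q d by fact
  show ?thesis
    by (intro q_geometric_operator.intro linear_operator_map_prod q_geometric_operator_axioms.intro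
        S.linear_operator_axioms T.linear_operator_axioms S.q_not_root_of_unity_axioms)
      (auto simp: op_poly_map_prod[OF S.linear_operator_axioms T.linear_operator_axioms]
        S.annihilated T.annihilated zero_prod_def)
qed

context box_operators
begin

abbreviation pair_op :: "4 \<Rightarrow> 'v \<times> 'v \<Rightarrow> 'v \<times> 'v" where
  "pair_op i \<equiv> map_prod (x i) (x (i + 2))"

lemma box_operators_pair: "box_operators (prod_scale scale) q d pair_op"
proof (rule box_operators.intro)
  fix i
  show "q_geometric_operator (prod_scale scale) (pair_op i) q d"
    by (intro q_geometric_operator_map_prod geometric)
  have "i + 1 + 2 = i + 2 + 1" by (simp add: add_ac)
  thus "q_weyl (prod_scale scale) q (pair_op i) (pair_op (i + 1))"
    using weyl[of i] weyl[of "i + 2"] by (auto simp: q_weyl_def minus_prod_def)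
  show "q_serre (prod_scale scale) q (pair_op i) (pair_op (i + 2))"
    using serre[of i] serre[of "i + 2"]
    by (auto simp: q_serre_def minus_prod_def plus_prod_def zero_prod_def)
qed

text \<open>
  The top eigenspace of \<open>x 1\<close> is the bottom eigenspace of \<open>x 0\<close>, and the top projection of \<open>x 3\<close> has
  the same kernel as the bottom projection of \<open>x 0\<close>.
\<close>

lemma top_eigenvector_eq_0:
  assumes "x 1 y = scale (th 0) y" "x.proj 3 0 y = 0"
  shows "y = 0"
proof -
  interpret w01: q_weyl_pair scale "x 0" "x 1" q d by (rule weyl_pair) simp
  interpret w30: q_weyl_pair scale "x 3" "x 0" q d by (rule weyl_pair) simp
  have "x.proj 0 d y = y"
    using x.proj_eigenvector[OF w01.right_top_imp_left_bottom[OF assms(1)]] by simp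
  thus ?thesis using w30.proj_right_left[of y] assms(2) by (simp add: x.proj.op_zero)
qed

text \<open>
  The preimage is found by undoing the two projections one after the other: the bottom projection of
  \<open>x 2\<close> inverts the top projection of \<open>x 1\<close>, and the bottom projection of \<open>x 0\<close> inverts the top
  projection of \<open>x 3\<close>.
\<close>

lemma top_eigenvector_return:
  assumes "x 1 z = scale (th 0) z"
  obtains y where "x 1 y = scale (th 0) y" "x.proj 1 0 (x.proj 3 0 y) = z"
proof -
  interpret w01: q_weyl_pair scale "x 0" "x 1" q d by (rule weyl_pair) simp
  interpret w12: q_weyl_pair scale "x 1" "x 2" q d by (rule weyl_pair) simp
  interpret w23: q_weyl_pair scale "x 2" "x 3" q d by (rule weyl_pair) simp
  interpret w30: q_weyl_pair scale "x 3" "x 0" q d by (rule weyl_pair) simp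
  define u where "u = x.proj 2 d z"
  define y where "y = x.proj 0 d u"
  have "x 3 u = scale (th 0) u"
    unfolding u_def by (rule w23.left_bottom_imp_right_top) (simp add: x.op_proj)
  hence "x.proj 3 0 u = u" using x.proj_eigenvector[of 3 u 0 0] by simp
  hence "x.proj 3 0 y = u" unfolding y_def using w30.proj_left_right[of u] by simp
  moreover have "x.proj 1 0 u = z"
    unfolding u_def using w12.proj_left_right[of z] x.proj_eigenvector[OF assms] by simp
  moreover have "x 1 y = scale (th 0) y"
    unfolding y_def by (rule w01.left_bottom_imp_right_top) (simp add: x.op_proj)
  ultimately show ?thesis using that by blast
qed

text \<open>
  The generators are the pairs \<open>(x.proj 3 0 y, y)\<close> of top eigenvectors that correspond to each other
  under the projection. The intertwining property \<open>proj_funpow_intertwine\<close> is exactly what makes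
  this set of pairs stable under the compressions of \<open>x 1\<close> on the first and \<open>x 3\<close> on the second
  factor.
\<close>

lemma graph_submodule:
  obtains M where "module.subspace (prod_scale scale) M"
    "\<And>i v w. (v, w) \<in> M \<Longrightarrow> (x i v, x (i + 2) w) \<in> M"
    "\<And>v w. (v, w) \<in> M \<Longrightarrow>
       x 1 (x.proj 1 0 w) = scale (th 0) (x.proj 1 0 w) \<and> x.proj 3 0 v = x.proj 3 0 (x.proj 1 0 w)"
    "\<And>y. x 1 y = scale (th 0) y \<Longrightarrow> (x.proj 3 0 y, y) \<in> M"
proof -
  interpret W: box_operators "prod_scale scale" q d pair_op by (rule box_operators_pair)
  interpret T: q_serre_pair scale "x 1" "x 3" q d by (rule odd_serre_pair)
  define U where "U = {(x.proj 3 0 y, y) | y. x 1 y = scale (th 0) y}"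
  have proj: "W.x.proj i n (v, w) = (x.proj i n v, x.proj (i + 2) n w)" for i n v w
    unfolding W.x.proj_def x.proj_def
    by (rule op_poly_map_prod[OF x.linear_operator_axioms x.linear_operator_axioms])
  have proj1: "W.x.proj 1 0 (v, w) = (x.proj 1 0 v, x.proj 3 0 w)"
    and proj3: "W.x.proj 3 0 (v, w) = (x.proj 3 0 v, x.proj 1 0 w)" for v w
    unfolding proj unfolding four_sums(1,2) by (rule refl)+
  have "W.x.subspace U"
    unfolding W.x.subspace_def
  proof (intro conjI ballI allI)
    show "0 \<in> U" unfolding U_def zero_prod_def using x.op_zero x.proj.op_zero by auto
    show "z + z' \<in> U" if "z \<in> U" "z' \<in> U" for z z'
      using that unfolding U_def
      by (auto simp: x.op_add x.proj.op_add x.scale_right_distrib)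
    show "prod_scale scale c z \<in> U" if "z \<in> U" for c z
      using that unfolding U_def
      by (auto simp: x.op_scale x.proj.op_scale mult.commute)
  qed
  moreover have "pair_op 3 u = prod_scale scale (th 0) u" if "u \<in> U" for u
    using that unfolding U_def four_sums by (auto simp: x.op_proj)
  moreover have "W.x.proj 3 0 ((pair_op 1 ^^ k) u) \<in> U" if u: "u \<in> U" for k u
  proof -
    obtain y where y: "u = (x.proj 3 0 y, y)" "x 1 y = scale (th 0) y"
      using u unfolding U_def by blast
    define z where "z = x.proj 1 0 ((x 3 ^^ k) y)"
    have "W.x.proj 3 0 ((pair_op 1 ^^ k) u) = (x.proj 3 0 z, z)"
      unfolding y(1) funpow_map_prod proj3 unfolding z_def four_sums(1,2)
      using T.proj_funpow_intertwine[OF y(2)] by simp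
    moreover have "x 1 z = scale (th 0) z" unfolding z_def by (rule x.op_proj) simp
    ultimately show ?thesis unfolding U_def by blast
  qed
  moreover have "U \<subseteq> W.x.proj 3 0 ` W.x.proj 1 0 ` U"
  proof
    fix u assume "u \<in> U"
    then obtain z where z: "u = (x.proj 3 0 z, z)" "x 1 z = scale (th 0) z"
      unfolding U_def by blast
    obtain y where y: "x 1 y = scale (th 0) y" "x.proj 1 0 (x.proj 3 0 y) = z"
      using top_eigenvector_return[OF z(2)] .
    have "u = W.x.proj 3 0 (W.x.proj 1 0 (x.proj 3 0 y, y))"
      unfolding proj1 proj3 unfolding z(1) y(2) by (rule refl)
    thus "u \<in> W.x.proj 3 0 ` W.x.proj 1 0 ` U" using y(1) unfolding U_def by blast
  qed
  ultimately obtain M where M: "W.x.subspace M" "U \<subseteq> M" "\<And>i z. z \<in> M \<Longrightarrow> pair_op i z \<in> M"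
    "\<And>z. z \<in> M \<Longrightarrow> W.x.proj 3 0 z \<in> U"
    using W.generated_submodule[of U] by blast
  show ?thesis
  proof (rule that[OF M(1)])
    show "(x i v, x (i + 2) w) \<in> M" if "(v, w) \<in> M" for i v w
      using M(3)[OF that, of i] by simp
    show "x 1 (x.proj 1 0 w) = scale (th 0) (x.proj 1 0 w) \<and>
        x.proj 3 0 v = x.proj 3 0 (x.proj 1 0 w)" if "(v, w) \<in> M" for v w
      using M(4)[OF that] unfolding proj3 U_def by auto
    show "(x.proj 3 0 y, y) \<in> M" if "x 1 y = scale (th 0) y" for y
      using that M(2) unfolding U_def by blast
  qed
qed

text \<open>
  The submodule from \<open>graph_submodule\<close> meets each factor in a submodule and projects onto a submodule
  of each factor. A top eigenvector in one of the factors would violate the description of the top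
  components, so the intersections vanish; the projections do not. Thus the submodule is the graph of
  a bijection.
\<close>

theorem irreducible_isomorphic_shift_2:
  assumes irreducible: "\<And>W. x.subspace W \<Longrightarrow> (\<And>i v. v \<in> W \<Longrightarrow> x i v \<in> W) \<Longrightarrow> W = {0} \<or> W = UNIV"
    and top1: "x 1 y\<^sub>0 = scale (th 0) y\<^sub>0" "y\<^sub>0 \<noteq> 0"
    and top3: "x 3 u\<^sub>0 = scale (th 0) u\<^sub>0" "u\<^sub>0 \<noteq> 0"
  obtains f where "linear_operator scale f" "bij f" "\<And>i v. f (x i v) = x (i + 2) (f v)"
proof -
  interpret P: vector_space "prod_scale scale" by (rule x.vector_space_prod_scale)
  obtain M where M: "P.subspace M"
    "\<And>i v w. (v, w) \<in> M \<Longrightarrow> (x i v, x (i + 2) w) \<in> M"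
    "\<And>v w. (v, w) \<in> M \<Longrightarrow>
       x 1 (x.proj 1 0 w) = scale (th 0) (x.proj 1 0 w) \<and> x.proj 3 0 v = x.proj 3 0 (x.proj 1 0 w)"
    "\<And>y. x 1 y = scale (th 0) y \<Longrightarrow> (x.proj 3 0 y, y) \<in> M"
    using graph_submodule by blast
  have M_zero: "(0, 0) \<in> M"
    using P.subspace_0[OF M(1)] by (simp add: zero_prod_def)
  have M_add: "(v + v', w + w') \<in> M" if "(v, w) \<in> M" "(v', w') \<in> M" for v w v' w'
    using P.subspace_add[OF M(1) that] by simp
  have M_scale: "(scale c v, scale c w) \<in> M" if "(v, w) \<in> M" for c v w
    using P.subspace_scale[OF M(1) that, of c] by (simp add:)
  have M_back: "(x (i + 2) v, x i w) \<in> M" if "(v, w) \<in> M" for i v w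
    using M(2)[OF that, of "i + 2"] by (simp add: four_add_four)
  have rep: "i = i + 2 + 2" for i :: 4 by (simp add: four_add_four)
  have y\<^sub>0: "x.proj 1 0 y\<^sub>0 = y\<^sub>0" "x.proj 3 0 y\<^sub>0 \<noteq> 0"
    using x.proj_eigenvector[OF top1(1)] top_eigenvector_eq_0 top1 by auto
  have u\<^sub>0: "x.proj 3 0 u\<^sub>0 = u\<^sub>0" using x.proj_eigenvector[OF top3(1)] by simp
  have "{v. (v, 0) \<in> M} = {0} \<or> {v. (v, 0) \<in> M} = UNIV"
  proof (rule irreducible)
    show "x.subspace {v. (v, 0) \<in> M}"
      unfolding x.subspace_def using M_zero M_add[of _ 0 _ 0] M_scale[of _ 0] by auto
    show "x i v \<in> {v. (v, 0) \<in> M}" if "v \<in> {v. (v, 0) \<in> M}" for i v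
      using M(2)[of v 0 i] that by (simp add: x.op_zero)
  qed
  moreover have "(u\<^sub>0, 0) \<notin> M"
    using M(3)[of u\<^sub>0 0] u\<^sub>0 top3(2) by (auto simp: x.proj.op_zero)
  ultimately have left: "v = 0" if "(v, 0) \<in> M" for v using that by blast
  have "{w. (0, w) \<in> M} = {0} \<or> {w. (0, w) \<in> M} = UNIV"
  proof (rule irreducible)
    show "x.subspace {w. (0, w) \<in> M}"
      unfolding x.subspace_def using M_zero M_add[of 0 _ 0] M_scale[of 0] by auto
    show "x i w \<in> {w. (0, w) \<in> M}" if "w \<in> {w. (0, w) \<in> M}" for i w
      using M_back[of 0 w i] that by (simp add: x.op_zero)
  qed
  moreover have "(0, y\<^sub>0) \<notin> M"
    using M(3)[of 0 y\<^sub>0] y\<^sub>0 by (auto simp: x.proj.op_zero)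
  ultimately have right: "w = 0" if "(0, w) \<in> M" for w using that by blast
  have "{v. \<exists>w. (v, w) \<in> M} = {0} \<or> {v. \<exists>w. (v, w) \<in> M} = UNIV"
  proof (rule irreducible)
    show "x.subspace {v. \<exists>w. (v, w) \<in> M}"
      unfolding x.subspace_def using M_zero M_add M_scale by blast
    show "x i v \<in> {v. \<exists>w. (v, w) \<in> M}" if "v \<in> {v. \<exists>w. (v, w) \<in> M}" for i v
      using M(2) that by blast
  qed
  moreover have "x.proj 3 0 y\<^sub>0 \<in> {v. \<exists>w. (v, w) \<in> M}" using M(4) top1(1) by blast
  ultimately have total: "\<exists>w. (v, w) \<in> M" for v using y\<^sub>0(2) by blast
  have "{w. \<exists>v. (v, w) \<in> M} = {0} \<or> {w. \<exists>v. (v, w) \<in> M} = UNIV"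
  proof (rule irreducible)
    show "x.subspace {w. \<exists>v. (v, w) \<in> M}"
      unfolding x.subspace_def using M_zero M_add M_scale by blast
    show "x i w \<in> {w. \<exists>v. (v, w) \<in> M}" if "w \<in> {w. \<exists>v. (v, w) \<in> M}" for i w
      using M_back that by blast
  qed
  moreover have "y\<^sub>0 \<in> {w. \<exists>v. (v, w) \<in> M}" using M(4) top1(1) by blast
  ultimately have onto: "\<exists>v. (v, w) \<in> M" for w using top1(2) by blast
  have M_diff: "(v - v', w - w') \<in> M" if "(v, w) \<in> M" "(v', w') \<in> M" for v w v' w'
    using P.subspace_diff[OF M(1) that] by simp
  have unique_right: "w = w'" if "(v, w) \<in> M" "(v, w') \<in> M" for v w w'
    using M_diff[OF that] right[of "w - w'"] by simp
  have unique_left: "v = v'" if "(v, w) \<in> M" "(v', w) \<in> M" for v v' w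
    using M_diff[OF that] left[of "v - v'"] by simp
  define f where "f v = (THE w. (v, w) \<in> M)" for v
  have f: "f v = w \<longleftrightarrow> (v, w) \<in> M" for v w
    unfolding f_def using total[of v] unique_right by (metis the_equality)
  have f_in: "(v, f v) \<in> M" for v using f by blast
  have "linear_operator scale f"
    by unfold_locales (use f f_in M_add M_scale in blast)+
  moreover have "bij f"
    by (rule bijI) (use f f_in unique_left onto in \<open>auto simp: inj_def surj_def, metis+\<close>)
  moreover have "f (x i v) = x (i + 2) (f v)" for i v
    using f f_in M(2) by blast
  ultimately show ?thesis using that by blast
qed

end

section \<open>Modules over \<open>\<box>\<^sub>q\<close>\<close>

lemma free_algebra_induct [case_names const gen_mult add]:
  assumes "\<And>c. P (free_const c)"
    and "\<And>i p. P p \<Longrightarrow> P (free_gen i * p)"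
    and "\<And>p r. P p \<Longrightarrow> P r \<Longrightarrow> P (p + r)"
  shows "P (p :: 'f::field free_algebra)"
proof (induction p rule: poly_mapping_induct_single)
  case 1
  have "(0 :: 'f free_algebra) = free_const 0" by (simp add: free_const_def)
  thus ?case using assms(1) by metis
next
  case (2 w c p)
  have "P (Poly_Mapping.single (Word is) c)" for "is"
  proof (induction "is")
    case Nil
    thus ?case using assms(1)[of c] by (simp add: free_const_def zero_word_def)
  next
    case (Cons i "is")
    have "Poly_Mapping.single (Word (i # is)) c = free_gen i * Poly_Mapping.single (Word is) c"
      by (simp add: free_gen_def mult_single plus_word_def)
    thus ?case using assms(2)[OF Cons] by simp
  qed
  thus ?case using 2 assms(3) by (metis word.exhaust)
qed

locale box_module = alg_module "box_algebra q" scale act + q_not_root_of_unity q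
  for q :: "'f::field" and scale :: "'f \<Rightarrow> 'v::ab_group_add \<Rightarrow> 'v" and act
begin

definition free_act :: "'f free_algebra \<Rightarrow> 'v \<Rightarrow> 'v" where
  "free_act p = act (box_proj q p)"

lemma box_proj_carrier: "box_proj q p \<in> carrier (box_algebra q)"
  by (simp add: carrier_box_algebra)

lemma free_act_add: "free_act (p + r) v = free_act p v + free_act r v"
  using act_add[OF box_proj_carrier box_proj_carrier] by (simp add: free_act_def box_algebra_simps)

lemma free_act_mult: "free_act (p * r) v = free_act p (free_act r v)"
  using act_mult[OF box_proj_carrier box_proj_carrier] by (simp add: free_act_def box_algebra_simps)

lemma free_act_one: "free_act 1 v = v"
  using act_one by (simp add: free_act_def box_algebra_simps)

lemma free_act_const: "free_act (free_const c) v = scale c v"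
  using act_smult[OF box_proj_carrier, of c 1 v] free_act_one[of v]
  by (simp add: free_act_def box_algebra_simps)

lemma free_act_diff: "free_act (p - r) v = free_act p v - free_act r v"
  using free_act_add[of "p - r" r v] by simp

sublocale free_act: linear_operator scale "free_act p" for p
proof -
  interpret f: Vector_Spaces.linear scale scale "free_act p"
    unfolding free_act_def by (rule act_linear[OF box_proj_carrier])
  show "linear_operator scale (free_act p)"
    by unfold_locales (simp_all add: f.add f.scale)
qed

abbreviation gen :: "4 \<Rightarrow> 'v \<Rightarrow> 'v" where "gen i \<equiv> free_act (free_gen i)"

lemma free_act_ideal:
  assumes "p \<in> box_ideal q"
  shows "free_act p v = 0"
proof -
  have "box_proj q r = box_ideal q" if "r \<in> box_ideal q" for r
    unfolding box_proj_def by (rule ring.a_rcos_zero[OF ring_free_ring ideal_box_ideal that])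
  moreover have "0 \<in> box_ideal q"
    using additive_subgroup.zero_closed[OF ideal.axioms(1)[OF ideal_box_ideal[of q]]] by simp
  ultimately have "free_act p v = free_act 0 v" using assms by (simp add: free_act_def)
  thus ?thesis using free_act_diff[of 0 0 v] by simp
qed

lemma relators_in_ideal: "q_weyl_relator q i \<in> box_ideal q" "q_serre_relator q i \<in> box_ideal q"
  using ring.genideal_self[OF ring_free_ring, of "range (q_weyl_relator q) \<union> range (q_serre_relator q)"]
  unfolding box_ideal_def by auto

lemma gen_weyl: "q_weyl scale q (gen i) (gen (i + 1))"
  unfolding q_weyl_def
proof
  fix v
  let ?w = "scale q (gen i (gen (i + 1) v)) - scale (inverse q) (gen (i + 1) (gen i v))"
  have "free_act (q_weyl_relator q i) v = 0" by (rule free_act_ideal[OF relators_in_ideal(1)])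
  hence "scale (1 / (q - inverse q)) ?w = v"
    by (simp add: q_weyl_relator_def Let_def free_act_diff free_act_mult free_act_const free_act_one)
  hence "scale (q - inverse q) (scale (1 / (q - inverse q)) ?w) = scale (q - inverse q) v" by simp
  thus "?w = scale (q - inverse q) v" using q_diff_nonzero by simp
qed

lemma gen_serre: "q_serre scale q (gen i) (gen (i + 2))"
  unfolding q_serre_def
proof
  fix v
  have "free_act (q_serre_relator q i) v = 0" by (rule free_act_ideal[OF relators_in_ideal(2)])
  thus "gen i (gen i (gen i (gen (i + 2) v)))
      - scale (q_bracket3 q) (gen i (gen i (gen (i + 2) (gen i v))))
      + scale (q_bracket3 q) (gen i (gen (i + 2) (gen i (gen i v))))
      - gen (i + 2) (gen i (gen i (gen i v))) = 0"
    by (simp add: q_serre_relator_def Let_def free_act_diff free_act_add free_act_mult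
        free_act_const power2_eq_square power3_eq_cube)
qed

lemma alg_submodule_if_gen_closed:
  assumes W: "V.subspace W" "\<And>i w. w \<in> W \<Longrightarrow> gen i w \<in> W"
  shows "alg_submodule W"
proof -
  have "free_act p w \<in> W" if "w \<in> W" for p w
    using that
  proof (induction p arbitrary: w rule: free_algebra_induct)
    case (const c)
    thus ?case using V.subspace_scale[OF W(1)] by (simp add: free_act_const)
  next
    case (gen_mult i p)
    thus ?case using W(2) by (simp add: free_act_mult)
  next
    case (add p r)
    thus ?case using V.subspace_add[OF W(1)] by (simp add: free_act_add)
  qed
  thus ?thesis using W(1) unfolding alg_submodule_def carrier_box_algebra free_act_def by auto
qed

lemma intertwiner_if_gen_intertwiner:
  assumes "linear_operator scale f" "\<And>i v. f (gen i v) = gen (i + 2) (f v)"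
    and "a \<in> carrier (box_algebra q)"
  shows "f (act a v) = twist (rho ^^ 2) act a (f v)"
proof -
  interpret f: linear_operator scale f by fact
  obtain p where p: "a = box_proj q p" using assms(3) by (auto simp: carrier_box_algebra)
  have "f (free_act p v) = free_act (free_shift (free_shift p)) (f v)" for p v
  proof (induction p arbitrary: v rule: free_algebra_induct)
    case (const c)
    show ?case by (simp add: free_act_const f.op_scale)
  next
    case (gen_mult i p)
    have "i + 1 + 1 = i + 2" by (simp add: add.assoc)
    thus ?case using gen_mult by (simp add: free_act_mult assms(2) add.commute)
  next
    case (add p r)
    thus ?case by (simp add: free_act_add f.op_add)
  qed
  thus ?thesis by (simp add: p twist_def numeral_2_eq_2 rho_box_proj free_act_def)
qed

text \<open>
  The eigenvectors of \<open>x\<^sub>i\<close> span a submodule: on an eigenvector, \<open>x\<^sub>i\<^sub>+\<^sub>1\<close> and \<open>x\<^sub>i\<^sub>-\<^sub>1\<close> act as a scalar plus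
  a shift of the eigenvalue by the Weyl relations, and the Serre cubic, which has distinct roots,
  splits the image under \<open>x\<^sub>i\<^sub>+\<^sub>2\<close> into eigenvectors.
\<close>

lemma gen_diagonalizable:
  assumes irr: irreducible_module
    and ev: "\<And>i. eigenvalues scale (gen i) = {q_geometric q d n | n. n \<le> d}"
  shows "q_geometric_operator scale (gen i) q d"
proof -
  define E where "E = {v. \<exists>c. gen i v = scale c v}"
  define W where "W = V.span E"
  have E_W: "v \<in> W" if "gen i v = scale c v" for c v
    using that unfolding W_def E_def by (intro V.span_base) blast
  have eigenvalue: "\<exists>n\<le>d. c = q_geometric q d n" if "gen i v = scale c v" "v \<noteq> 0" for c v
    using ev[of i] that unfolding eigenvalues_def by blast
  have on_E: "gen j v \<in> W" if v: "gen i v = scale c v" "v \<noteq> 0" for c v j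
  proof -
    have c: "c \<noteq> 0" using eigenvalue[OF v] by auto
    have step: "gen j v \<in> W" if "gen i (gen j v - scale (inverse c) v) =
        scale c' (gen j v - scale (inverse c) v)" for c'
    proof -
      have "gen j v = (gen j v - scale (inverse c) v) + scale (inverse c) v" by simp
      thus ?thesis
        using E_W[OF that] E_W[OF v(1)] V.span_add V.span_scale unfolding W_def by metis
    qed
    consider "j = i" | "j = i + 1" | "j = i + 2" | "i = j + 1"
      using index_four_cases[of j i] four_add_four(2)[of i] by auto
    thus ?thesis
    proof cases
      case 1
      thus ?thesis using E_W[OF v(1)] v(1) V.span_scale unfolding W_def by simp
    next
      case 2
      thus ?thesis
        using step free_act.q_weyl_eigenvector_left[OF _ q_nonzero v(1) c free_act.linear_operator_axioms]
          gen_weyl[of i] by blast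
    next
      case 4
      hence "q_weyl scale q (gen j) (gen i)" using gen_weyl[of j] by simp
      thus ?thesis
        using step free_act.q_weyl_eigenvector_right[OF _ q_nonzero v(1) c free_act.linear_operator_axioms]
        by blast
    next
      case 3
      define y where "y k = q powi (2 * k) * c" for k
      have inj: "inj_on y {-1, 0, 1}"
        using c q_powi_eq_iff by (auto simp: inj_on_def y_def)
      have "0 = gen i (gen i (gen i (gen j v))) - scale (q_bracket3 q) (gen i (gen i (gen j (gen i v))))
        + scale (q_bracket3 q) (gen i (gen j (gen i (gen i v)))) - gen j (gen i (gen i (gen i v)))"
        using gen_serre[of i] 3 unfolding q_serre_def by metis
      also have "\<dots> = free_act.op_poly (free_gen i)
          [:- (c ^ 3), q_bracket3 q * c ^ 2, - (q_bracket3 q * c), 1:] (gen j v)"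
        by (simp add: free_act.op_poly_pCons free_act.op_zero v(1) free_act.op_scale
            free_act.op_add free_act.op_diff power2_eq_square power3_eq_cube mult_ac)
      finally have "free_act.op_poly (free_gen i) (\<Prod>k\<in>{-1, 0, 1}. [:- y k, 1:]) (gen j v) = 0"
        unfolding serre_cubic_factorization y_def by simp
      note split = free_act.eigenvector_decomposition[OF _ inj _ this]
      have "(\<Sum>k\<in>{-1, 0, 1}. free_act.op_poly (free_gen i) (lagrange_poly y {-1, 0, 1} k) (gen j v)) \<in> W"
        unfolding W_def by (intro V.span_sum) (use split(2) E_W in \<open>unfold W_def, blast\<close>)
      thus ?thesis using split(1) by simp
    qed
  qed
  have "alg_submodule W"
  proof (rule alg_submodule_if_gen_closed)
    show "V.subspace W" unfolding W_def by (rule V.subspace_span)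
    fix j w assume "w \<in> W"
    have "V.subspace {w. gen j w \<in> W}"
      unfolding W_def V.subspace_def
      by (auto simp: free_act.op_zero free_act.op_add free_act.op_scale
          V.span_zero V.span_add V.span_scale)
    moreover have "E \<subseteq> {w. gen j w \<in> W}"
    proof
      fix v assume "v \<in> E"
      then obtain c where "gen i v = scale c v" unfolding E_def by blast
      thus "v \<in> {w. gen j w \<in> W}"
        using on_E[of v c j] V.span_zero[of E] by (cases "v = 0") (auto simp: free_act.op_zero W_def)
    qed
    ultimately show "gen j w \<in> W" using \<open>w \<in> W\<close> V.span_minimal unfolding W_def by blast
  qed
  moreover have "W \<noteq> {0}"
  proof -
    have "q_geometric q d 0 \<in> eigenvalues scale (gen i)" using ev by blast
    then obtain v where "v \<noteq> 0" "gen i v = scale (q_geometric q d 0) v"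
      unfolding eigenvalues_def by blast
    thus ?thesis using E_W by blast
  qed
  ultimately have W: "W = UNIV" using irr unfolding irreducible_module_def by blast
  have "free_act.op_poly (free_gen i) (\<Prod>n\<le>d. [:- q_geometric q d n, 1:]) v = 0" for v
  proof -
    let ?p = "\<Prod>n\<le>d. [:- q_geometric q d n, 1:]"
    interpret p: linear_operator scale "free_act.op_poly (free_gen i) ?p"
      by (rule free_act.linear_operator_op_poly)
    have "V.subspace {v. free_act.op_poly (free_gen i) ?p v = 0}"
      by (auto simp: V.subspace_def p.op_zero p.op_add p.op_scale)
    moreover have "E \<subseteq> {v. free_act.op_poly (free_gen i) ?p v = 0}"
    proof
      fix v assume "v \<in> E"
      then obtain c where c: "gen i v = scale c v" unfolding E_def by blast
      show "v \<in> {v. free_act.op_poly (free_gen i) ?p v = 0}"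
      proof (cases "v = 0")
        case False
        then obtain n where "n \<le> d" "c = q_geometric q d n" using eigenvalue[OF c] by blast
        hence "poly ?p c = 0" by (auto simp: poly_prod)
        thus ?thesis using free_act.op_poly_eigenvector[OF c] by simp
      qed (simp add: p.op_zero)
    qed
    ultimately have "W \<subseteq> {v. free_act.op_poly (free_gen i) ?p v = 0}"
      unfolding W_def by (intro V.span_minimal)
    thus ?thesis using W by blast
  qed
  thus ?thesis
    by (intro q_geometric_operator.intro q_geometric_operator_axioms.intro
        free_act.linear_operator_axioms q_not_root_of_unity_axioms)
qed

end

theorem corollary1p7:
  fixes q :: "'f::{alg_closed_field, field_char_0}"
    and scale :: "'f \<Rightarrow> 'v::ab_group_add \<Rightarrow> 'v"
    and act :: "'f free_algebra set \<Rightarrow> 'v \<Rightarrow> 'v"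
  assumes "q \<noteq> 0"
    and "\<And>n::nat. n > 0 \<Longrightarrow> q ^ n \<noteq> 1"
    and "alg_module (box_algebra q) scale act"
    and "vector_space.finite_dim scale"
    and "alg_module.irreducible_module (box_algebra q) scale act"
    and "box_type q scale act 1"
  shows "alg_module_isomorphic (box_algebra q) scale act scale (twist (rho ^^ 2) act)"
proof -
  interpret box_module q scale act
    using assms(1-3) by (intro box_module.intro q_not_root_of_unity.intro)
  obtain d where "box_type_diameter q scale act 1 d" using assms(6) unfolding box_type_def by blast
  moreover have "act (box_gen q i) = gen i" for i by (simp add: free_act_def box_gen_def)
  ultimately have ev: "eigenvalues scale (gen i) = {q_geometric q d n | n. n \<le> d}" for i
    using index_four_cases[of i 0]
    unfolding box_type_diameter_def by (auto simp: q_geometric_def)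
  interpret box_operators scale q d gen
    by (intro box_operators.intro gen_diagonalizable[OF assms(5) ev] gen_weyl gen_serre)
  have top: "\<exists>v. gen i v = scale (th 0) v \<and> v \<noteq> 0" for i
  proof -
    have "th 0 \<in> eigenvalues scale (gen i)" using ev by blast
    thus ?thesis unfolding eigenvalues_def by blast
  qed
  obtain y u where yu: "gen 1 y = scale (th 0) y" "y \<noteq> 0" "gen 3 u = scale (th 0) u" "u \<noteq> 0"
    using top[of 1] top[of 3] by blast
  have irr: "W = {0} \<or> W = UNIV" if "V.subspace W" "\<And>i v. v \<in> W \<Longrightarrow> gen i v \<in> W" for W
    using assms(5) alg_submodule_if_gen_closed[OF that] unfolding irreducible_module_def by blast
  obtain f where f: "linear_operator scale f" "bij f" "\<And>i v. f (gen i v) = gen (i + 2) (f v)"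
    using irreducible_isomorphic_shift_2[OF irr yu] by blast
  interpret f: linear_operator scale f by (rule f)
  have "Vector_Spaces.linear scale scale f"
    by unfold_locales (simp_all add: f.op_add f.op_scale)
  thus ?thesis
    unfolding alg_module_isomorphic_def using f(2) intertwiner_if_gen_intertwiner[OF f(1,3)] by blast
qed

end
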